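(* For $0\le r_1,r_2,r_3\le n$ and $0\le s\le\min(r_1,n-r_1,r_2,n-r_2,r_3,n-r_3)$, $$\Lambda_s^{r_2,r_3}\circ\Lambda_s^{r_1,r_2}=\frac{\binom{n}{r_2}}{\binom{n}{s}-\binom{n}{s-1}}\,\Lambda_s^{r_1,r_3}.$$
   Context: Let $\Omega$ be a finite set with $|\Omega|=n\ge1$, $G=S(\Omega)$, $X=\mathcal P(\Omega)$, $X_r=\{x\in X:|x|=r\}$, $G$ acting on $L^2(X)$ (complex functions on $X$; $L^2(X_r)$ = functions supported on $X_r$) by $(\rho(g)\psi)(x)=\psi(g^{-1}x)$. For $0\le s\le\min(r,n-r)$, $L^2(X_r)_s$ is the unique irreducible $G$-subspace of $L^2(X_r)$ isomorphic to the irreducible representation associated with the partition $(n-s,s)$. For $0\le s\le\min(r_1,n-r_1,r_2,n-r_2)$, $\Lambda_s^{r_1,r_2}$ is a $G$-equivariant map $L^2(X)\to L^2(X)$ sending $L^2(X_{r_1})_s$ into $L^2(X_{r_2})_s$ and vanishing on its orthogonal complement, with kernel $\lambda$ defined on integers $\max(0,r_2-r_1)\le k\le\min(n-r_1,r_2)$ by $(\Lambda_s^{r_1,r_2}\psi)(x_2)=\sum_{x_1\in X_{r_1}}\lambda(|x_2\setminus x_1|)\psi(x_1)$. The kernel agrees on its domain with a unique polynomial of degree $s$ which is nonzero at $0$; $\Lambda_s^{r_1,r_2}$ is normalized so that this polynomial takes the value $1$ at $t=0$. Convention $\binom{n}{-1}=0$. *)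

theory Defs
  imports Main "HOL-Combinatorics.Permutations" "HOL-Computational_Algebra.Polynomial"
begin

text \<open>Functions on X = P(Omega) are modelled as complex functions on 'a set;
 L^2(X) consists of those vanishing outside Pow Omega.\<close>

definition L2X :: "'a set \<Rightarrow> ('a set \<Rightarrow> complex) set" where
  "L2X \<Omega> = {\<psi>. \<forall>x. \<not> x \<subseteq> \<Omega> \<longrightarrow> \<psi> x = 0}"

definition Xr :: "'a set \<Rightarrow> nat \<Rightarrow> 'a set set" where
  "Xr \<Omega> r = {x. x \<subseteq> \<Omega> \<and> card x = r}"

definition L2Xr :: "'a set \<Rightarrow> nat \<Rightarrow> ('a set \<Rightarrow> complex) set" where
  "L2Xr \<Omega> r = {\<psi>. \<forall>x. x \<notin> Xr \<Omega> r \<longrightarrow> \<psi> x = 0}"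

definition act :: "('a \<Rightarrow> 'a) \<Rightarrow> ('a set \<Rightarrow> complex) \<Rightarrow> ('a set \<Rightarrow> complex)" where
  "act g \<psi> = (\<lambda>x. \<psi> (inv g ` x))"

definition csubspace :: "('a set \<Rightarrow> complex) set \<Rightarrow> bool" where
  "csubspace V \<longleftrightarrow> (\<lambda>_. 0) \<in> V \<and> (\<forall>f\<in>V. \<forall>g\<in>V. (\<lambda>x. f x + g x) \<in> V)
     \<and> (\<forall>c. \<forall>f\<in>V. (\<lambda>x. c * f x) \<in> V)"

definition cspan :: "('a set \<Rightarrow> complex) set \<Rightarrow> ('a set \<Rightarrow> complex) set" where
  "cspan S = {f. \<exists>F c. finite F \<and> F \<subseteq> S \<and> f = (\<lambda>x. \<Sum>g\<in>F. c g * g x)}"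

definition G_invariant :: "'a set \<Rightarrow> ('a set \<Rightarrow> complex) set \<Rightarrow> bool" where
  "G_invariant \<Omega> V \<longleftrightarrow> (\<forall>g. g permutes \<Omega> \<longrightarrow> (\<forall>\<psi>\<in>V. act g \<psi> \<in> V))"

definition G_subspace :: "'a set \<Rightarrow> ('a set \<Rightarrow> complex) set \<Rightarrow> bool" where
  "G_subspace \<Omega> V \<longleftrightarrow> csubspace V \<and> G_invariant \<Omega> V"

definition G_irreducible :: "'a set \<Rightarrow> ('a set \<Rightarrow> complex) set \<Rightarrow> bool" where
  "G_irreducible \<Omega> V \<longleftrightarrow> G_subspace \<Omega> V \<and> V \<noteq> {\<lambda>_. 0} \<and>
     (\<forall>W. G_subspace \<Omega> W \<and> W \<subseteq> V \<longrightarrow> W = {\<lambda>_. 0} \<or> W = V)"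

definition G_isomorphic :: "'a set \<Rightarrow> ('a set \<Rightarrow> complex) set \<Rightarrow> ('a set \<Rightarrow> complex) set \<Rightarrow> bool" where
  "G_isomorphic \<Omega> V W \<longleftrightarrow> (\<exists>T. bij_betw T V W
      \<and> (\<forall>f\<in>V. \<forall>g\<in>V. T (\<lambda>x. f x + g x) = (\<lambda>x. T f x + T g x))
      \<and> (\<forall>c. \<forall>f\<in>V. T (\<lambda>x. c * f x) = (\<lambda>x. c * T f x))
      \<and> (\<forall>g. g permutes \<Omega> \<longrightarrow> (\<forall>f\<in>V. T (act g f) = act g (T f))))"

text \<open>Polytabloid of shape (n-s,s) with columns {a i, b i}, i < s, realised in the
 permutation module L^2(X_s): e(x) = prod_i ([a i in x] - [b i in x]) on X_s.\<close>
definition polytabloid :: "'a set \<Rightarrow> nat \<Rightarrow> (nat \<Rightarrow> 'a) \<Rightarrow> (nat \<Rightarrow> 'a) \<Rightarrow> ('a set \<Rightarrow> complex)" where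
  "polytabloid \<Omega> s a b = (\<lambda>x. if x \<in> Xr \<Omega> s then
      (\<Prod>i<s. (if a i \<in> x then 1 else 0) - (if b i \<in> x then 1 else 0)) else 0)"

definition specht :: "'a set \<Rightarrow> nat \<Rightarrow> ('a set \<Rightarrow> complex) set" where
  "specht \<Omega> s = cspan {polytabloid \<Omega> s a b | a b.
      (\<forall>i<s. a i \<in> \<Omega> \<and> b i \<in> \<Omega>) \<and> inj_on (\<lambda>j. if j < s then a j else b (j - s)) {..<2*s}}"

definition L2Xrs :: "'a set \<Rightarrow> nat \<Rightarrow> nat \<Rightarrow> ('a set \<Rightarrow> complex) set" where
  "L2Xrs \<Omega> r s = (THE V. V \<subseteq> L2Xr \<Omega> r \<and> G_irreducible \<Omega> V \<and> G_isomorphic \<Omega> V (specht \<Omega> s))"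

definition orth_compl :: "'a set \<Rightarrow> ('a set \<Rightarrow> complex) set \<Rightarrow> ('a set \<Rightarrow> complex) set" where
  "orth_compl \<Omega> V = {\<phi> \<in> L2X \<Omega>. \<forall>\<psi>\<in>V. (\<Sum>x\<in>Pow \<Omega>. \<phi> x * cnj (\<psi> x)) = 0}"

definition kernel_op :: "'a set \<Rightarrow> nat \<Rightarrow> nat \<Rightarrow> complex poly \<Rightarrow> ('a set \<Rightarrow> complex) \<Rightarrow> ('a set \<Rightarrow> complex)" where
  "kernel_op \<Omega> r1 r2 p \<psi> = (\<lambda>x2. if x2 \<in> Xr \<Omega> r2 then
      (\<Sum>x1\<in>Xr \<Omega> r1. poly p (of_nat (card (x2 - x1))) * \<psi> x1) else 0)"

definition is_Lambda :: "'a set \<Rightarrow> nat \<Rightarrow> nat \<Rightarrow> nat \<Rightarrow> (('a set \<Rightarrow> complex) \<Rightarrow> ('a set \<Rightarrow> complex)) \<Rightarrow> bool" where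
  "is_Lambda \<Omega> s r1 r2 L \<longleftrightarrow>
     (\<exists>p. degree p = s \<and> poly p 0 = 1 \<and> L = kernel_op \<Omega> r1 r2 p)
     \<and> (\<forall>g. g permutes \<Omega> \<longrightarrow> (\<forall>\<psi>\<in>L2X \<Omega>. L (act g \<psi>) = act g (L \<psi>)))
     \<and> (\<forall>\<psi>\<in>L2Xrs \<Omega> r1 s. L \<psi> \<in> L2Xrs \<Omega> r2 s)
     \<and> (\<forall>\<psi>\<in>orth_compl \<Omega> (L2Xrs \<Omega> r1 s). L \<psi> = (\<lambda>_. 0))"

definition Lambda :: "'a set \<Rightarrow> nat \<Rightarrow> nat \<Rightarrow> nat \<Rightarrow> ('a set \<Rightarrow> complex) \<Rightarrow> ('a set \<Rightarrow> complex)" where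
  "Lambda \<Omega> s r1 r2 = (THE L. is_Lambda \<Omega> s r1 r2 L)"

definition ichoose :: "nat \<Rightarrow> int \<Rightarrow> int" where
  "ichoose n k = (if k < 0 then 0 else int (n choose nat k))"

end

theory Submission
  imports Defs "HOL-Library.Function_Algebras" "HOL-Computational_Algebra.Formal_Power_Series"
begin

text \<open>
  Call a function on the \<open>s\<close>-subsets harmonic if its sum over the \<open>s\<close>-subsets containing any given
  \<open>(s - 1)\<close>-subset vanishes.  Double counting shows that the sum of a harmonic \<open>f\<close> over all \<open>w\<close> with
  \<open>card (w - x) = j\<close> is \<open>(-1) ^ j * (s choose j)\<close> times its sum \<open>lift f x\<close> over the \<open>s\<close>-subsets of \<open>x\<close>.
  Since the orbits of \<open>G\<close> on pairs \<open>(w, x)\<close> are given by \<open>card (w - x)\<close>, every equivariant map from the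
  harmonic functions to functions on \<open>r\<close>-subsets is a multiple of \<open>lift\<close>, which is Schur's lemma with
  multiplicity one.  The harmonic functions form an irreducible space, namely the Specht module, and
  \<open>L2Xrs\<close> is its image under \<open>lift\<close>.

  For an \<open>r\<close>-subset \<open>y\<close> the harmonic function of \<open>z\<close> that depends only on \<open>card (z - y)\<close> is explicit.
  Summing against it gives an equivariant map \<open>zonal_op\<close> back to the harmonic functions, vanishing
  on the orthogonal complement of \<open>L2Xrs\<close>.  The kernel of \<open>lift \<circ> zonal_op\<close> is a polynomial in
  \<open>card (x - y)\<close> of degree \<open>s\<close> with value \<open>r2 choose s\<close> at \<open>0\<close>, so \<open>Lambda\<close> is this map divided by
  \<open>r2 choose s\<close>.  The theorem thus amounts to computing the scalar \<open>zonal_op \<circ> lift\<close>, which follows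
  from the norm of \<open>lift f\<close> and from the adjoint of \<open>zonal_op\<close>.
\<close>

section \<open>Subsets and permutations\<close>

lemma finite_Xr [simp]: "finite \<Omega> \<Longrightarrow> finite (Xr \<Omega> r)"
  by (simp add: Xr_def)

lemma Xr_imp_finite: "finite \<Omega> \<Longrightarrow> x \<in> Xr \<Omega> r \<Longrightarrow> finite x"
  by (auto simp: Xr_def intro: finite_subset)

lemma card_Int_Diff_Xr:
  assumes "finite \<Omega>" "x \<in> Xr \<Omega> r"
  shows "card (x \<inter> y) + card (x - y) = r"
  using card_Int_Diff[OF Xr_imp_finite[OF assms], of y] assms(2) by (simp add: Xr_def)

lemma Xr_subset_iff_eq:
  assumes "finite \<Omega>" "x \<in> Xr \<Omega> r" "y \<in> Xr \<Omega> r"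
  shows "x \<subseteq> y \<longleftrightarrow> x = y"
  using card_subset_eq[OF Xr_imp_finite[OF assms(1,3)], of x] assms(2,3) by (auto simp: Xr_def)

lemma permutes_image_Xr_iff:
  assumes "g permutes \<Omega>"
  shows "g ` x \<in> Xr \<Omega> r \<longleftrightarrow> x \<in> Xr \<Omega> r"
proof -
  have "inj g" using assms by (rule permutes_inj)
  moreover have "g ` x \<subseteq> \<Omega> \<longleftrightarrow> x \<subseteq> \<Omega>"
    by (metis assms \<open>inj g\<close> inj_image_subset_iff permutes_image)
  ultimately show ?thesis by (simp add: Xr_def card_image inj_on_subset)
qed

lemma permutes_image_inv:
  assumes "g permutes \<Omega>"
  shows "g ` inv g ` x = x" "inv g ` g ` x = x"
  using permutes_bij[OF assms] by (simp_all add: bij_betw_def image_f_inv_f image_inv_f_f)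

lemma sum_Xr_permutes:
  assumes "g permutes \<Omega>"
  shows "(\<Sum>x\<in>Xr \<Omega> r. f (g ` x)) = (\<Sum>x\<in>Xr \<Omega> r. f x)"
  by (rule sum.reindex_bij_witness[of _ "image (inv g)" "image g"])
     (auto simp: permutes_image_inv[OF assms] permutes_image_Xr_iff permutes_inv assms)

lemma card_Diff_permutes: "g permutes \<Omega> \<Longrightarrow> card (g ` x - g ` y) = card (x - y)"
  by (metis card_image image_set_diff inj_on_subset permutes_inj top_greatest)

lemma permutes_image_eqI:
  assumes "g permutes \<Omega>" "x \<subseteq> \<Omega>" "y \<subseteq> \<Omega>" "\<And>a. a \<in> \<Omega> \<Longrightarrow> a \<in> x \<longleftrightarrow> g a \<in> y"
  shows "g ` x = y"
proof
  show "g ` x \<subseteq> y" using assms(2,4) by blast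
  show "y \<subseteq> g ` x"
  proof
    fix b assume "b \<in> y"
    then obtain a where "a \<in> \<Omega>" "b = g a" using assms(3) permutes_image[OF assms(1)] by blast
    then show "b \<in> g ` x" using assms(4) \<open>b \<in> y\<close> by blast
  qed
qed

lemma permutes_pair_transitive:
  assumes fin: "finite \<Omega>" and x_mem: "x \<in> Xr \<Omega> r" "x' \<in> Xr \<Omega> r" and z_mem: "z \<in> Xr \<Omega> s" "z' \<in> Xr \<Omega> s"
    and outside_eq: "card (z - x) = card (z' - x')"
  obtains g where "g permutes \<Omega>" "g ` x = x'" "g ` z = z'"
proof -
  have sub: "x \<subseteq> \<Omega>" "x' \<subseteq> \<Omega>" "z \<subseteq> \<Omega>" "z' \<subseteq> \<Omega>" using x_mem z_mem by (auto simp: Xr_def)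
  have inside_eq: "card (z \<inter> x) = card (z' \<inter> x')"
    using card_Int_Diff_Xr[OF fin z_mem(1), of x] card_Int_Diff_Xr[OF fin z_mem(2), of x'] outside_eq
    by simp
  have outside_eq': "card (x - z) = card (x' - z')"
    using card_Int_Diff_Xr[OF fin x_mem(1), of z] card_Int_Diff_Xr[OF fin x_mem(2), of z'] inside_eq
    by (simp add: Int_commute)
  have card_Compl: "card (\<Omega> - (z \<union> x)) = card \<Omega> - (s + card (x - z))"
    if "x \<in> Xr \<Omega> r" "z \<in> Xr \<Omega> s" for x z
    using that Xr_imp_finite[OF fin that(1)] Xr_imp_finite[OF fin that(2)] card_Un_disjoint[of z "x - z"]
    by (simp add: Xr_def card_Diff_subset)
  have "card {a \<in> \<Omega>. (a \<in> x, a \<in> z) = c} = card {a \<in> \<Omega>. (a \<in> x', a \<in> z') = c}" for c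
  proof (cases c)
    case (Pair p q)
    have blocks: "{a \<in> \<Omega>. (a \<in> x, a \<in> z) = (p, q)} =
        (if p then if q then z \<inter> x else x - z else if q then z - x else \<Omega> - (z \<union> x))"
      if "x \<subseteq> \<Omega>" "z \<subseteq> \<Omega>" for x z
      using that by auto
    show ?thesis
      unfolding Pair blocks[OF sub(1,3)] blocks[OF sub(2,4)]
      using inside_eq outside_eq outside_eq' card_Compl[OF x_mem(1) z_mem(1)]
        card_Compl[OF x_mem(2) z_mem(2)]
      by simp
  qed
  then have same_colours:
    "image_mset (\<lambda>a. (a \<in> x, a \<in> z)) (mset_set \<Omega>) = image_mset (\<lambda>a. (a \<in> x', a \<in> z')) (mset_set \<Omega>)"
    using fin
    by (intro multiset_eqI) (simp add: count_image_mset' Int_def conj_commute eq_commute cong: conj_cong)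
  obtain g where g_perm: "g permutes \<Omega>" and "\<forall>a\<in>\<Omega>. (a \<in> x, a \<in> z) = (g a \<in> x', g a \<in> z')"
    by (rule image_mset_eq_implies_permutes[OF fin same_colours])
  then have "g ` x = x'" "g ` z = z'" using sub by (simp_all add: permutes_image_eqI[OF g_perm])
  then show ?thesis by (rule that[OF g_perm])
qed

lemma card_subsets_Int_Diff:
  assumes "finite x"
  shows "card {z. z \<subseteq> x \<and> card (z \<inter> y) = i \<and> card (z - y) = j}
    = (card (x \<inter> y) choose i) * (card (x - y) choose j)"
proof -
  let ?S = "\<lambda>x i. {z. z \<subseteq> x \<and> card z = i}"
  have "bij_betw (\<lambda>(u, v). u \<union> v) (?S (x \<inter> y) i \<times> ?S (x - y) j)
    {z. z \<subseteq> x \<and> card (z \<inter> y) = i \<and> card (z - y) = j}"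
  proof (rule bij_betw_byWitness[where f' = "\<lambda>z. (z \<inter> y, z - y)"])
    have "(u \<union> v) \<inter> y = u" "u \<union> v - y = v" if "u \<subseteq> x \<inter> y" "v \<subseteq> x - y" for u v
      using that by auto
    then show "(\<lambda>(u, v). u \<union> v) ` (?S (x \<inter> y) i \<times> ?S (x - y) j)
        \<subseteq> {z. z \<subseteq> x \<and> card (z \<inter> y) = i \<and> card (z - y) = j}"
      by auto
  qed auto
  then have "card {z. z \<subseteq> x \<and> card (z \<inter> y) = i \<and> card (z - y) = j}
      = card (?S (x \<inter> y) i \<times> ?S (x - y) j)"
    by (rule bij_betw_same_card[symmetric])
  also have "\<dots> = card (?S (x \<inter> y) i) * card (?S (x - y) j)" by (rule card_cartesian_product)
  finally show ?thesis using assms n_subsets[of "x \<inter> y" i] n_subsets[of "x - y" j] by simp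
qed

lemma sum_insert_eq_sum_remove:
  assumes fin: "finite \<Omega>"
  shows "(\<Sum>u\<in>Xr \<Omega> k. \<Sum>a\<in>\<Omega> - u. F u (insert a u)) = (\<Sum>w\<in>Xr \<Omega> (Suc k). \<Sum>a\<in>w. F (w - {a}) w)"
proof -
  have "(\<Sum>(u, a)\<in>Sigma (Xr \<Omega> k) (\<lambda>u. \<Omega> - u). F u (insert a u))
    = (\<Sum>(w, a)\<in>Sigma (Xr \<Omega> (Suc k)) (\<lambda>w. w). F (w - {a}) w)"
    by (rule sum.reindex_bij_witness[of _ "\<lambda>(w, a). (w - {a}, a)" "\<lambda>(u, a). (insert a u, a)"])
       (auto simp: Xr_def insert_absorb card_Diff_singleton intro: finite_subset[OF _ fin]
          intro!: card_insert_disjoint)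
  then show ?thesis
    using fin by (simp add: sum.Sigma Xr_imp_finite[OF fin])
qed

lemma card_disjoint_supersets:
  assumes fin: "finite \<Omega>" and v_mem: "v \<in> Xr \<Omega> s" and w_mem: "w \<in> Xr \<Omega> t" and "s \<le> r"
  shows "card {y \<in> Xr \<Omega> r. v \<subseteq> y \<and> y \<inter> w = {}}
    = (if v \<inter> w = {} then (card \<Omega> - s - t) choose (r - s) else 0)"
proof (cases "v \<inter> w = {}")
  case True
  have fin_vw: "finite v" "finite w" using Xr_imp_finite[OF fin] v_mem w_mem by auto
  have "bij_betw (\<lambda>u. v \<union> u) {u. u \<subseteq> \<Omega> - (v \<union> w) \<and> card u = r - s} {y \<in> Xr \<Omega> r. v \<subseteq> y \<and> y \<inter> w = {}}"
  proof (rule bij_betw_byWitness[where f' = "\<lambda>y. y - v"])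
    have "card (v \<union> u) = r" if "u \<subseteq> \<Omega> - (v \<union> w)" "card u = r - s" for u
      using that fin_vw v_mem \<open>s \<le> r\<close> finite_subset[OF that(1)] fin
      by (subst card_Un_disjoint) (auto simp: Xr_def)
    then show "(\<lambda>u. v \<union> u) ` {u. u \<subseteq> \<Omega> - (v \<union> w) \<and> card u = r - s} \<subseteq> {y \<in> Xr \<Omega> r. v \<subseteq> y \<and> y \<inter> w = {}}"
      using True v_mem unfolding Xr_def by blast
    show "(\<lambda>y. y - v) ` {y \<in> Xr \<Omega> r. v \<subseteq> y \<and> y \<inter> w = {}} \<subseteq> {u. u \<subseteq> \<Omega> - (v \<union> w) \<and> card u = r - s}"
      using fin_vw v_mem by (auto simp: Xr_def card_Diff_subset)
  qed auto
  then have "card {y \<in> Xr \<Omega> r. v \<subseteq> y \<and> y \<inter> w = {}} = card {u. u \<subseteq> \<Omega> - (v \<union> w) \<and> card u = r - s}"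
    by (simp add: bij_betw_same_card)
  also have "\<dots> = card (\<Omega> - (v \<union> w)) choose (r - s)" using fin by (simp add: n_subsets)
  also have "card (\<Omega> - (v \<union> w)) = card \<Omega> - s - t"
    using v_mem w_mem fin_vw True by (simp add: Xr_def card_Diff_subset card_Un_disjoint)
  finally show ?thesis using True by simp
next
  case False
  then have no_superset: "{y \<in> Xr \<Omega> r. v \<subseteq> y \<and> y \<inter> w = {}} = {}" by blast
  show ?thesis unfolding no_superset using False by simp
qed

section \<open>Equivariant maps\<close>

interpretation cfun: vector_space "\<lambda>(c :: complex) (f :: 'a set \<Rightarrow> complex) x. c * f x"
  by unfold_locales (simp_all add: fun_eq_iff algebra_simps)

lemma sum_fun_eq: "(\<Sum>i\<in>I. f i) = (\<lambda>x. \<Sum>i\<in>I. f i x :: complex)"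
  by (induction I rule: infinite_finite_induct) (auto simp: fun_eq_iff)

lemma csubspace_iff_subspace: "csubspace V \<longleftrightarrow> cfun.subspace V"
  by (simp add: csubspace_def cfun.subspace_def zero_fun_def plus_fun_def)

lemma cspan_eq_span: "cspan S = cfun.span S"
  unfolding cspan_def cfun.span_explicit sum_fun_eq by auto

lemma csubspace_sum:
  assumes "csubspace V" "\<And>i. i \<in> I \<Longrightarrow> f i \<in> V"
  shows "(\<lambda>x. \<Sum>i\<in>I. c i * f i x) \<in> V"
proof -
  have "(\<Sum>i\<in>I. (\<lambda>x. c i * f i x)) \<in> V"
    using assms unfolding csubspace_iff_subspace
    by (intro cfun.subspace_sum cfun.subspace_scale)
  then show ?thesis by (simp add: sum_fun_eq)
qed

lemma G_subspaceD:
  assumes "G_subspace \<Omega> V"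
  shows "csubspace V" "(\<lambda>_. 0) \<in> V" "\<And>f h. f \<in> V \<Longrightarrow> h \<in> V \<Longrightarrow> (\<lambda>x. f x + h x) \<in> V"
    "\<And>c f. f \<in> V \<Longrightarrow> (\<lambda>x. c * f x) \<in> V" "\<And>g f. g permutes \<Omega> \<Longrightarrow> f \<in> V \<Longrightarrow> act g f \<in> V"
  using assms by (auto simp: G_subspace_def csubspace_def G_invariant_def)

definition G_hom ::
    "'a set \<Rightarrow> ('a set \<Rightarrow> complex) set \<Rightarrow> (('a set \<Rightarrow> complex) \<Rightarrow> 'a set \<Rightarrow> complex) \<Rightarrow> bool" where
  "G_hom \<Omega> V T \<longleftrightarrow> (\<forall>f\<in>V. \<forall>h\<in>V. T (\<lambda>x. f x + h x) = (\<lambda>x. T f x + T h x))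
    \<and> (\<forall>c. \<forall>f\<in>V. T (\<lambda>x. c * f x) = (\<lambda>x. c * T f x))
    \<and> (\<forall>g. g permutes \<Omega> \<longrightarrow> (\<forall>f\<in>V. T (act g f) = act g (T f)))"

lemma G_homD:
  assumes "G_hom \<Omega> V T"
  shows "f \<in> V \<Longrightarrow> h \<in> V \<Longrightarrow> T (\<lambda>x. f x + h x) = (\<lambda>x. T f x + T h x)"
    "f \<in> V \<Longrightarrow> T (\<lambda>x. c * f x) = (\<lambda>x. c * T f x)"
    "g permutes \<Omega> \<Longrightarrow> f \<in> V \<Longrightarrow> T (act g f) = act g (T f)"
  using assms by (auto simp: G_hom_def)

lemma G_hom_0:
  assumes "G_hom \<Omega> V T" "(\<lambda>_. 0) \<in> V"
  shows "T (\<lambda>_. 0) = (\<lambda>_. 0)"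
  using G_homD(2)[OF assms, of 0] by simp

lemma G_isomorphic_iff: "G_isomorphic \<Omega> V W \<longleftrightarrow> (\<exists>T. bij_betw T V W \<and> G_hom \<Omega> V T)"
  by (simp add: G_isomorphic_def G_hom_def)

lemma G_hom_sum:
  assumes T_hom: "G_hom \<Omega> V T" and V_sub: "csubspace V" and f_mem: "\<And>i. i \<in> I \<Longrightarrow> f i \<in> V"
  shows "T (\<lambda>x. \<Sum>i\<in>I. c i * f i x) = (\<lambda>x. \<Sum>i\<in>I. c i * T (f i) x)"
  using f_mem
proof (induction I rule: infinite_finite_induct)
  case (insert i I)
  then have "(\<lambda>x. c i * f i x) \<in> V" "(\<lambda>x. \<Sum>i\<in>I. c i * f i x) \<in> V"
    using V_sub csubspace_sum[OF V_sub, of I f c] by (auto simp: csubspace_def)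
  then show ?case
    using insert G_homD(1,2)[OF T_hom] by simp
qed (use G_hom_0[OF T_hom] V_sub in \<open>simp_all add: csubspace_def\<close>)

lemma G_hom_comp:
  assumes "G_hom \<Omega> V T" "G_hom \<Omega> W S" "T ` V \<subseteq> W"
  shows "G_hom \<Omega> V (S \<circ> T)"
  using assms unfolding G_hom_def by (simp add: image_subset_iff)

lemma G_hom_inv_into:
  assumes V_sub: "G_subspace \<Omega> V" and T_hom: "G_hom \<Omega> V T" and inj: "inj_on T V"
  shows "G_hom \<Omega> (T ` V) (inv_into V T)"
  unfolding G_hom_def ball_simps
proof (intro conjI allI impI ballI)
  fix f h assume "f \<in> V" "h \<in> V"
  moreover from this have "inv_into V T (T (\<lambda>x. f x + h x)) = (\<lambda>x. f x + h x)"
    by (intro inv_into_f_f inj G_subspaceD[OF V_sub])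
  ultimately show "inv_into V T (\<lambda>x. T f x + T h x) = (\<lambda>x. inv_into V T (T f) x + inv_into V T (T h) x)"
    by (simp add: G_homD[OF T_hom] inv_into_f_f[OF inj])
next
  fix c f assume "f \<in> V"
  moreover from this have "inv_into V T (T (\<lambda>x. c * f x)) = (\<lambda>x. c * f x)"
    by (intro inv_into_f_f inj G_subspaceD[OF V_sub])
  ultimately show "inv_into V T (\<lambda>x. c * T f x) = (\<lambda>x. c * inv_into V T (T f) x)"
    by (simp add: G_homD[OF T_hom] inv_into_f_f[OF inj])
next
  fix g f assume "g permutes \<Omega>" "f \<in> V"
  moreover from this have "inv_into V T (T (act g f)) = act g f"
    by (intro inv_into_f_f inj G_subspaceD[OF V_sub])
  ultimately show "inv_into V T (act g (T f)) = act g (inv_into V T (T f))"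
    by (simp add: G_homD[OF T_hom] inv_into_f_f[OF inj])
qed

lemma G_isomorphic_sym:
  assumes "G_subspace \<Omega> V" "G_isomorphic \<Omega> V W"
  shows "G_isomorphic \<Omega> W V"
proof -
  obtain T where T_bij: "bij_betw T V W" and T_hom: "G_hom \<Omega> V T"
    using assms(2) by (auto simp: G_isomorphic_iff)
  then have "G_hom \<Omega> W (inv_into V T)"
    using G_hom_inv_into[OF assms(1) T_hom] by (simp add: bij_betw_def)
  then show ?thesis using bij_betw_inv_into[OF T_bij] by (auto simp: G_isomorphic_iff)
qed

lemma G_subspace_image:
  assumes V_sub: "G_subspace \<Omega> V" and T_hom: "G_hom \<Omega> V T"
  shows "G_subspace \<Omega> (T ` V)"
proof -
  have "(\<lambda>_. 0) \<in> T ` V"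
    using imageI[OF G_subspaceD(2)[OF V_sub], of T] G_hom_0[OF T_hom G_subspaceD(2)[OF V_sub]] by simp
  then show ?thesis
    unfolding G_subspace_def csubspace_def G_invariant_def
    by (auto simp: G_homD[OF T_hom, symmetric] G_subspaceD[OF V_sub])
qed

lemma G_subspace_vimage:
  assumes "G_subspace \<Omega> V" "G_subspace \<Omega> W" "G_hom \<Omega> V T"
  shows "G_subspace \<Omega> {f \<in> V. T f \<in> W}"
  unfolding G_subspace_def csubspace_def G_invariant_def
  by (simp add: G_hom_0[OF assms(3)] G_homD[OF assms(3)] G_subspaceD[OF assms(1)] G_subspaceD[OF assms(2)])

lemma G_irreducible_image:
  assumes V_irred: "G_irreducible \<Omega> V" and T_hom: "G_hom \<Omega> V T" and inj: "inj_on T V"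
  shows "G_irreducible \<Omega> (T ` V)"
  unfolding G_irreducible_def
proof (intro conjI allI impI)
  have V_sub: "G_subspace \<Omega> V" and "V \<noteq> {\<lambda>_. 0}" using V_irred by (simp_all add: G_irreducible_def)
  note zero_mem = G_subspaceD(2)[OF V_sub]
  note T_zero = G_hom_0[OF T_hom zero_mem]
  show "G_subspace \<Omega> (T ` V)" by (rule G_subspace_image[OF V_sub T_hom])
  obtain f where "f \<in> V" "f \<noteq> (\<lambda>_. 0)" using \<open>V \<noteq> {\<lambda>_. 0}\<close> zero_mem by blast
  then have "T f \<noteq> (\<lambda>_. 0)" using inj_onD[OF inj _ _ zero_mem] T_zero by metis
  then show "T ` V \<noteq> {\<lambda>_. 0}" using \<open>f \<in> V\<close> by blast
  fix W assume W_sub: "G_subspace \<Omega> W \<and> W \<subseteq> T ` V"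
  let ?U = "{f \<in> V. T f \<in> W}"
  have "G_subspace \<Omega> ?U" using G_subspace_vimage[OF V_sub _ T_hom] W_sub by blast
  then have "?U = {\<lambda>_. 0} \<or> ?U = V" using V_irred unfolding G_irreducible_def by blast
  moreover have "W = T ` ?U" using W_sub by auto
  ultimately show "W = {\<lambda>_. 0} \<or> W = T ` V" using T_zero by auto
qed

section \<open>Integral operators between the layers\<close>

definition integral_op ::
    "'a set \<Rightarrow> nat \<Rightarrow> nat \<Rightarrow> ('a set \<Rightarrow> 'a set \<Rightarrow> complex) \<Rightarrow> ('a set \<Rightarrow> complex) \<Rightarrow> 'a set \<Rightarrow> complex" where
  "integral_op \<Omega> r1 r2 k f = (\<lambda>x. if x \<in> Xr \<Omega> r2 then \<Sum>y\<in>Xr \<Omega> r1. k x y * f y else 0)"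

definition inner_X :: "'a set \<Rightarrow> ('a set \<Rightarrow> complex) \<Rightarrow> ('a set \<Rightarrow> complex) \<Rightarrow> complex" where
  "inner_X \<Omega> f h = (\<Sum>x\<in>Pow \<Omega>. f x * cnj (h x))"

lemma integral_op_L2Xr: "integral_op \<Omega> r1 r2 k f \<in> L2Xr \<Omega> r2"
  by (simp add: integral_op_def L2Xr_def)

lemma kernel_op_eq_integral_op:
  "kernel_op \<Omega> r1 r2 p = integral_op \<Omega> r1 r2 (\<lambda>x y. poly p (of_nat (card (x - y))))"
  by (simp add: kernel_op_def integral_op_def fun_eq_iff)

lemma integral_op_linear:
  "integral_op \<Omega> r1 r2 k (\<lambda>x. f x + h x) = (\<lambda>x. integral_op \<Omega> r1 r2 k f x + integral_op \<Omega> r1 r2 k h x)"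
  "integral_op \<Omega> r1 r2 k (\<lambda>x. c * f x) = (\<lambda>x. c * integral_op \<Omega> r1 r2 k f x)"
  by (simp_all add: integral_op_def fun_eq_iff sum.distrib sum_distrib_left algebra_simps)

lemma integral_op_act:
  assumes inv: "\<And>x y. k (g ` x) (g ` y) = k x y" and g_perm: "g permutes \<Omega>"
  shows "integral_op \<Omega> r1 r2 k (act g f) = act g (integral_op \<Omega> r1 r2 k f)"
proof
  fix x
  have "(\<Sum>y\<in>Xr \<Omega> r1. k x y * f (inv g ` y)) = (\<Sum>y\<in>Xr \<Omega> r1. k x (g ` y) * f y)"
    using sum_Xr_permutes[OF g_perm, of "\<lambda>y. k x y * f (inv g ` y)" r1]
    by (simp add: permutes_image_inv[OF g_perm])
  also have "\<dots> = (\<Sum>y\<in>Xr \<Omega> r1. k (inv g ` x) y * f y)"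
    using inv[of "inv g ` x"] by (simp add: permutes_image_inv[OF g_perm])
  finally show "integral_op \<Omega> r1 r2 k (act g f) x = act g (integral_op \<Omega> r1 r2 k f) x"
    by (simp add: integral_op_def act_def permutes_image_Xr_iff[OF permutes_inv[OF g_perm]])
qed

lemma G_hom_integral_op:
  assumes "\<And>g x y. g permutes \<Omega> \<Longrightarrow> k (g ` x) (g ` y) = k x y"
  shows "G_hom \<Omega> V (integral_op \<Omega> r1 r2 k)"
  unfolding G_hom_def by (simp add: integral_op_linear integral_op_act assms)

lemma G_hom_kernel_op: "G_hom \<Omega> V (kernel_op \<Omega> r1 r2 p)"
  unfolding kernel_op_eq_integral_op by (intro G_hom_integral_op) (simp add: card_Diff_permutes)

lemma integral_op_integral_op:
  "integral_op \<Omega> r2 r3 k (integral_op \<Omega> r1 r2 l f)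
    = integral_op \<Omega> r1 r3 (\<lambda>x z. \<Sum>y\<in>Xr \<Omega> r2. k x y * l y z) f"
proof
  fix x
  have "(\<Sum>y\<in>Xr \<Omega> r2. k x y * (\<Sum>z\<in>Xr \<Omega> r1. l y z * f z))
    = (\<Sum>z\<in>Xr \<Omega> r1. (\<Sum>y\<in>Xr \<Omega> r2. k x y * l y z) * f z)"
    unfolding sum_distrib_left sum_distrib_right by (subst sum.swap) (simp add: mult.assoc)
  then show "integral_op \<Omega> r2 r3 k (integral_op \<Omega> r1 r2 l f) x
    = integral_op \<Omega> r1 r3 (\<lambda>x z. \<Sum>y\<in>Xr \<Omega> r2. k x y * l y z) f x"
    by (simp add: integral_op_def)
qed

lemma inner_X_L2Xr:
  assumes "finite \<Omega>" "f \<in> L2Xr \<Omega> r \<or> h \<in> L2Xr \<Omega> r"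
  shows "inner_X \<Omega> f h = (\<Sum>x\<in>Xr \<Omega> r. f x * cnj (h x))"
  unfolding inner_X_def using assms by (intro sum.mono_neutral_right) (auto simp: Xr_def L2Xr_def)

lemma inner_X_integral_op:
  assumes "finite \<Omega>"
  shows "inner_X \<Omega> (integral_op \<Omega> r1 r2 k f) h = inner_X \<Omega> f (integral_op \<Omega> r2 r1 (\<lambda>y x. cnj (k x y)) h)"
proof -
  have "(\<Sum>x\<in>Xr \<Omega> r2. (\<Sum>y\<in>Xr \<Omega> r1. k x y * f y) * cnj (h x))
    = (\<Sum>y\<in>Xr \<Omega> r1. f y * cnj (\<Sum>x\<in>Xr \<Omega> r2. cnj (k x y) * h x))"
    by (simp add: sum_distrib_left sum_distrib_right mult_ac) (rule sum.swap)
  then show ?thesis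
    unfolding inner_X_L2Xr[OF assms disjI1[OF integral_op_L2Xr]]
      inner_X_L2Xr[OF assms disjI2[OF integral_op_L2Xr]]
    by (simp add: integral_op_def)
qed

lemma inner_X_self_eq_0_iff:
  assumes fin: "finite \<Omega>" and f_mem: "f \<in> L2Xr \<Omega> r"
  shows "inner_X \<Omega> f f = 0 \<longleftrightarrow> f = (\<lambda>_. 0)"
proof
  assume "inner_X \<Omega> f f = 0"
  then have "complex_of_real (\<Sum>x\<in>Xr \<Omega> r. (cmod (f x))\<^sup>2) = 0"
    by (simp only: inner_X_L2Xr[OF fin disjI1[OF f_mem]] of_real_sum complex_norm_square)
  then have "(\<Sum>x\<in>Xr \<Omega> r. (cmod (f x))\<^sup>2) = 0" by (simp only: of_real_eq_0_iff)
  then have "\<forall>x\<in>Xr \<Omega> r. f x = 0"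
    using fin by (subst (asm) sum_nonneg_eq_0_iff) auto
  then show "f = (\<lambda>_. 0)" using f_mem by (auto simp: L2Xr_def fun_eq_iff)
qed (simp add: inner_X_def)

section \<open>Harmonic functions on a layer\<close>

definition harmonic :: "'a set \<Rightarrow> nat \<Rightarrow> ('a set \<Rightarrow> complex) set" where
  "harmonic \<Omega> s = {f \<in> L2Xr \<Omega> s. \<forall>u. u \<subseteq> \<Omega> \<and> Suc (card u) = s \<longrightarrow> (\<Sum>a\<in>\<Omega> - u. f (insert a u)) = 0}"

definition lift :: "'a set \<Rightarrow> nat \<Rightarrow> nat \<Rightarrow> ('a set \<Rightarrow> complex) \<Rightarrow> 'a set \<Rightarrow> complex" where
  "lift \<Omega> s r = integral_op \<Omega> s r (\<lambda>x z. of_bool (z \<subseteq> x))"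

lemma harmonicD:
  assumes "f \<in> harmonic \<Omega> s"
  shows "f \<in> L2Xr \<Omega> s" "u \<subseteq> \<Omega> \<Longrightarrow> Suc (card u) = s \<Longrightarrow> (\<Sum>a\<in>\<Omega> - u. f (insert a u)) = 0"
  using assms by (auto simp: harmonic_def)

lemma G_subspace_harmonic: "G_subspace \<Omega> (harmonic \<Omega> s)"
  unfolding G_subspace_def G_invariant_def
proof (intro conjI allI impI ballI)
  show "csubspace (harmonic \<Omega> s)"
    by (auto simp: csubspace_def harmonic_def L2Xr_def sum.distrib simp flip: sum_distrib_left)
  fix g f assume "g permutes \<Omega>" and f_harm: "f \<in> harmonic \<Omega> s"
  then have inv_perm: "inv g permutes \<Omega>" by (simp add: permutes_inv)
  have "(\<Sum>a\<in>\<Omega> - u. f (inv g ` insert a u)) = 0" if "u \<subseteq> \<Omega>" "Suc (card u) = s" for u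
  proof -
    have "bij_betw (inv g) (\<Omega> - u) (\<Omega> - inv g ` u)"
      using permutes_image[OF inv_perm] permutes_inj[OF inv_perm]
        inj_on_subset[OF permutes_inj[OF inv_perm], of "\<Omega> - u"]
      by (simp add: bij_betw_def image_set_diff)
    then have "(\<Sum>a\<in>\<Omega> - u. f (inv g ` insert a u)) = (\<Sum>a\<in>\<Omega> - inv g ` u. f (insert a (inv g ` u)))"
      by (subst sum.reindex_bij_betw[symmetric]) simp_all
    also have "\<dots> = 0"
    proof (rule harmonicD(2)[OF f_harm])
      show "inv g ` u \<subseteq> \<Omega>" using that(1) permutes_image[OF inv_perm] by blast
      show "Suc (card (inv g ` u)) = s"
        using that(2) card_image[OF inj_on_subset[OF permutes_inj[OF inv_perm]], of u] by simp
    qed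
    finally show ?thesis .
  qed
  moreover have "act g f \<in> L2Xr \<Omega> s"
    using harmonicD(1)[OF f_harm] by (simp add: L2Xr_def act_def permutes_image_Xr_iff[OF inv_perm])
  ultimately show "act g f \<in> harmonic \<Omega> s" by (simp add: harmonic_def act_def)
qed

lemma lift_eq_sum_subsets:
  assumes "finite \<Omega>" "x \<in> Xr \<Omega> r"
  shows "lift \<Omega> s r f x = (\<Sum>z\<in>{z \<in> Xr \<Omega> s. z \<subseteq> x}. f z)"
  using assms by (simp add: lift_def integral_op_def Int_def)

lemma lift_same:
  assumes fin: "finite \<Omega>" and f_mem: "f \<in> L2Xr \<Omega> s"
  shows "lift \<Omega> s s f = f"
proof
  fix x
  show "lift \<Omega> s s f x = f x"
  proof (cases "x \<in> Xr \<Omega> s")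
    case True
    then have "{z \<in> Xr \<Omega> s. z \<subseteq> x} = {x}" using Xr_subset_iff_eq[OF fin] by blast
    then show ?thesis by (simp add: lift_eq_sum_subsets[OF fin True])
  qed (use f_mem in \<open>simp add: lift_def integral_op_def L2Xr_def\<close>)
qed

lemma G_hom_lift: "G_hom \<Omega> V (lift \<Omega> s r)"
  unfolding lift_def
  by (intro G_hom_integral_op) (simp add: inj_image_subset_iff permutes_inj)

lemma sum_of_bool_card_remove:
  assumes "finite w"
  shows "(\<Sum>a\<in>w. of_bool (card (w - {a} - x) = j))
    = of_nat (card w - j) * of_bool (card (w - x) = j)
      + of_nat (Suc j) * (of_bool (card (w - x) = Suc j) :: 'b :: comm_semiring_1)"
proof -
  have "(\<Sum>a\<in>w. of_bool (card (w - {a} - x) = j) :: 'b)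
    = (\<Sum>a\<in>w \<inter> x. of_bool (card (w - {a} - x) = j)) + (\<Sum>a\<in>w - x. of_bool (card (w - {a} - x) = j))"
    using assms by (rule sum.Int_Diff)
  also have "(\<Sum>a\<in>w \<inter> x. of_bool (card (w - {a} - x) = j)) = (\<Sum>a\<in>w \<inter> x. of_bool (card (w - x) = j) :: 'b)"
  proof (intro sum.cong refl)
    fix a assume "a \<in> w \<inter> x"
    then have "w - {a} - x = w - x" by blast
    then show "of_bool (card (w - {a} - x) = j) = (of_bool (card (w - x) = j) :: 'b)" by simp
  qed
  also have "\<dots> = of_nat (card w - j) * of_bool (card (w - x) = j)"
    using card_Int_Diff[OF assms, of x] by auto
  also have "(\<Sum>a\<in>w - x. of_bool (card (w - {a} - x) = j)) = (\<Sum>a\<in>w - x. of_bool (card (w - x) = Suc j) :: 'b)"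
  proof (intro sum.cong refl)
    fix a assume outside: "a \<in> w - x"
    have "w - {a} - x = w - x - {a}" by blast
    then have "Suc (card (w - {a} - x)) = card (w - x)"
      using card_Suc_Diff1[OF _ outside] assms by simp
    then show "of_bool (card (w - {a} - x) = j) = (of_bool (card (w - x) = Suc j) :: 'b)" by auto
  qed
  also have "\<dots> = of_nat (Suc j) * of_bool (card (w - x) = Suc j)" by auto
  finally show ?thesis .
qed

lemma harmonic_shell_recursion:
  assumes fin: "finite \<Omega>" and f_harm: "f \<in> harmonic \<Omega> s"
  shows "of_nat (s - j) * (\<Sum>w\<in>{w \<in> Xr \<Omega> s. card (w - x) = j}. f w)
    + of_nat (Suc j) * (\<Sum>w\<in>{w \<in> Xr \<Omega> s. card (w - x) = Suc j}. f w) = 0"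
proof (cases s)
  case 0
  then have "w = {}" if "w \<in> Xr \<Omega> s" for w
    using that Xr_imp_finite[OF fin that] by (simp add: Xr_def)
  then have no_set: "{w \<in> Xr \<Omega> s. card (w - x) = Suc j} = {}" by force
  show ?thesis unfolding no_set using 0 by simp
next
  case (Suc k)
  define F where "F = (\<lambda>u w. of_bool (card (u - x) = j) * f w)"
  have sum_remove: "(\<Sum>a\<in>w. F (w - {a}) w) = of_nat (s - j) * (if card (w - x) = j then f w else 0)
      + of_nat (Suc j) * (if card (w - x) = Suc j then f w else 0)" if "w \<in> Xr \<Omega> s" for w
    using that sum_of_bool_card_remove[OF Xr_imp_finite[OF fin that], of x j, where 'b = complex]
    by (auto simp: F_def Xr_def simp flip: sum_distrib_right)
  have "(\<Sum>a\<in>\<Omega> - u. F u (insert a u)) = 0" if "u \<in> Xr \<Omega> k" for u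
    using harmonicD(2)[OF f_harm, of u] that Suc by (simp add: F_def Xr_def flip: sum_distrib_left)
  then have "0 = (\<Sum>u\<in>Xr \<Omega> k. \<Sum>a\<in>\<Omega> - u. F u (insert a u))" by simp
  also have "\<dots> = (\<Sum>w\<in>Xr \<Omega> s. \<Sum>a\<in>w. F (w - {a}) w)"
    unfolding Suc by (rule sum_insert_eq_sum_remove[OF fin])
  also have "\<dots> = of_nat (s - j) * (\<Sum>w\<in>{w \<in> Xr \<Omega> s. card (w - x) = j}. f w)
      + of_nat (Suc j) * (\<Sum>w\<in>{w \<in> Xr \<Omega> s. card (w - x) = Suc j}. f w)"
    using fin
    by (simp add: sum_remove sum.inter_filter sum.distrib del: of_nat_Suc flip: sum_distrib_left)
  finally show ?thesis by simp
qed

lemma harmonic_shell_sum: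
  assumes fin: "finite \<Omega>" and f_harm: "f \<in> harmonic \<Omega> s" and x_mem: "x \<in> Xr \<Omega> r"
  shows "(\<Sum>w\<in>{w \<in> Xr \<Omega> s. card (w - x) = j}. f w) = (-1) ^ j * of_nat (s choose j) * lift \<Omega> s r f x"
proof (induction j)
  case 0
  have "{w \<in> Xr \<Omega> s. card (w - x) = 0} = {w \<in> Xr \<Omega> s. w \<subseteq> x}"
    using Xr_imp_finite[OF fin, of _ s] by (auto dest: finite_Diff)
  then show ?case by (simp add: lift_eq_sum_subsets[OF fin x_mem])
next
  case (Suc j)
  have "Suc j * (s choose Suc j) = (s - j) * (s choose j)"
    by (simp only: binomial_absorption binomial_absorb_comp)
  then have binomial:
    "of_nat (Suc j) * of_nat (s choose Suc j) = (of_nat (s - j) * of_nat (s choose j) :: complex)"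
    by (simp only: flip: of_nat_mult)
  have "of_nat (Suc j) * (\<Sum>w\<in>{w \<in> Xr \<Omega> s. card (w - x) = Suc j}. f w)
    = - (of_nat (s - j) * (\<Sum>w\<in>{w \<in> Xr \<Omega> s. card (w - x) = j}. f w))"
    using harmonic_shell_recursion[OF fin f_harm, of j x] by (simp only: add_eq_0_iff2 add.commute)
  also have "\<dots> = (-1) ^ Suc j * (of_nat (s - j) * of_nat (s choose j)) * lift \<Omega> s r f x"
    by (simp add: Suc.IH)
  also have "\<dots> = of_nat (Suc j) * ((-1) ^ Suc j * of_nat (s choose Suc j) * lift \<Omega> s r f x)"
    unfolding binomial[symmetric] by (simp only: mult_ac)
  finally show ?case by (simp only: mult_cancel_left of_nat_eq_0_iff) simp
qed

lemma sum_shell_kernel_harmonic: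
  assumes fin: "finite \<Omega>" and f_harm: "f \<in> harmonic \<Omega> s" and x_mem: "x \<in> Xr \<Omega> r"
  shows "(\<Sum>w\<in>Xr \<Omega> s. \<phi> (card (w - x)) * f w)
    = (\<Sum>j\<le>s. (-1) ^ j * of_nat (s choose j) * \<phi> j) * lift \<Omega> s r f x"
proof -
  have "card (w - x) \<le> s" if "w \<in> Xr \<Omega> s" for w
    using card_Int_Diff_Xr[OF fin that, of x] by simp
  then have "(\<Sum>w\<in>Xr \<Omega> s. \<phi> (card (w - x)) * f w)
    = (\<Sum>j\<le>s. \<Sum>w\<in>{w \<in> Xr \<Omega> s. card (w - x) = j}. \<phi> (card (w - x)) * f w)"
    using fin by (intro sum.group[symmetric]) auto
  also have "\<dots> = (\<Sum>j\<le>s. \<phi> j * (\<Sum>w\<in>{w \<in> Xr \<Omega> s. card (w - x) = j}. f w))"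
    unfolding sum_distrib_left by (intro sum.cong refl) simp
  finally show ?thesis
    by (simp add: harmonic_shell_sum[OF fin f_harm x_mem] sum_distrib_left sum_distrib_right mult_ac)
qed

lemma harmonic_eq_0I:
  assumes fin: "finite \<Omega>" and f_harm: "f \<in> harmonic \<Omega> s" and y_mem: "y \<in> Xr \<Omega> r"
    and shell: "\<And>w z. w \<in> Xr \<Omega> s \<Longrightarrow> z \<in> Xr \<Omega> s \<Longrightarrow> card (w - y) = card (z - y) \<Longrightarrow> f w = f z"
    and lift_zero: "lift \<Omega> s r f y = 0"
  shows "f = (\<lambda>_. 0)"
proof
  fix z
  show "f z = 0"
  proof (cases "z \<in> Xr \<Omega> s")
    case True
    let ?S = "{w \<in> Xr \<Omega> s. card (w - y) = card (z - y)}"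
    have "(\<Sum>w\<in>?S. f w) = (\<Sum>w\<in>?S. f z)" by (intro sum.cong refl shell) (use True in auto)
    moreover have "(\<Sum>w\<in>?S. f w) = 0"
      by (simp only: harmonic_shell_sum[OF fin f_harm y_mem] lift_zero mult_zero_right)
    ultimately have "of_nat (card ?S) * f z = 0" by (simp only: sum_constant)
    moreover have "card ?S \<noteq> 0" using True fin by auto
    ultimately show ?thesis by simp
  qed (use harmonicD(1)[OF f_harm] in \<open>simp add: L2Xr_def\<close>)
qed

lemma lift_eq_sum_disjoint:
  assumes fin: "finite \<Omega>" and f_harm: "f \<in> harmonic \<Omega> s" and x_mem: "x \<in> Xr \<Omega> r"
  shows "lift \<Omega> s r f x = (-1) ^ s * (\<Sum>w\<in>{w \<in> Xr \<Omega> s. x \<inter> w = {}}. f w)"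
proof -
  have "card (w - x) = s \<longleftrightarrow> x \<inter> w = {}" if "w \<in> Xr \<Omega> s" for w
    using card_Int_Diff_Xr[OF fin that, of x] Xr_imp_finite[OF fin that] by (auto simp: Int_commute)
  then have "{w \<in> Xr \<Omega> s. card (w - x) = s} = {w \<in> Xr \<Omega> s. x \<inter> w = {}}" by blast
  then have "(\<Sum>w\<in>{w \<in> Xr \<Omega> s. x \<inter> w = {}}. f w) = (-1) ^ s * lift \<Omega> s r f x"
    using harmonic_shell_sum[OF fin f_harm x_mem, of s] by simp
  then show ?thesis by (simp flip: mult.assoc power_mult_distrib)
qed

lemma sum_supersets_lift:
  assumes fin: "finite \<Omega>" and f_harm: "f \<in> harmonic \<Omega> s" and z_mem: "z \<in> Xr \<Omega> s" and "s \<le> r"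
  shows "(\<Sum>y\<in>{y \<in> Xr \<Omega> r. z \<subseteq> y}. lift \<Omega> s r f y) = of_nat ((card \<Omega> - 2 * s) choose (r - s)) * f z"
proof -
  let ?N = "(card \<Omega> - 2 * s) choose (r - s)" and ?Y = "{y \<in> Xr \<Omega> r. z \<subseteq> y}"
  have count: "card {y \<in> ?Y. y \<inter> w = {}} = (if z \<inter> w = {} then ?N else 0)" if "w \<in> Xr \<Omega> s" for w
    using card_disjoint_supersets[OF fin z_mem that \<open>s \<le> r\<close>] by (simp add: conj_assoc mult_2)
  have "(\<Sum>y\<in>?Y. lift \<Omega> s r f y) = (-1) ^ s * (\<Sum>y\<in>?Y. \<Sum>w\<in>{w \<in> Xr \<Omega> s. y \<inter> w = {}}. f w)"
    by (simp add: lift_eq_sum_disjoint[OF fin f_harm] sum_distrib_left)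
  also have "(\<Sum>y\<in>?Y. \<Sum>w\<in>{w \<in> Xr \<Omega> s. y \<inter> w = {}}. f w)
    = (\<Sum>w\<in>Xr \<Omega> s. \<Sum>y\<in>{y \<in> ?Y. y \<inter> w = {}}. f w)"
    using fin by (intro sum.swap_restrict) auto
  also have "\<dots> = (\<Sum>w\<in>Xr \<Omega> s. if z \<inter> w = {} then of_nat ?N * f w else 0)"
    by (intro sum.cong refl) (simp only: sum_constant count, simp)
  also have "\<dots> = of_nat ?N * (\<Sum>w\<in>{w \<in> Xr \<Omega> s. z \<inter> w = {}}. f w)"
    using fin by (simp add: sum.inter_filter sum_distrib_left if_distrib cong: if_cong)
  finally show ?thesis
    using lift_eq_sum_disjoint[OF fin f_harm z_mem]
    by (simp add: lift_same[OF fin harmonicD(1)[OF f_harm]])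
qed

lemma inner_X_lift_lift:
  assumes fin: "finite \<Omega>" and f_mem: "f \<in> L2Xr \<Omega> s" and h_harm: "h \<in> harmonic \<Omega> s" and "s \<le> r"
  shows "inner_X \<Omega> (lift \<Omega> s r f) (lift \<Omega> s r h)
    = of_nat ((card \<Omega> - 2 * s) choose (r - s)) * inner_X \<Omega> f h"
proof -
  let ?N = "of_nat ((card \<Omega> - 2 * s) choose (r - s)) :: complex"
  have adjoint_lift: "integral_op \<Omega> r s (\<lambda>z y. cnj (of_bool (z \<subseteq> y))) (lift \<Omega> s r h) z = ?N * h z"
    if "z \<in> Xr \<Omega> s" for z
    using that fin sum_supersets_lift[OF fin h_harm that \<open>s \<le> r\<close>]
    by (simp add: integral_op_def of_bool_def sum.inter_filter if_distrib if_distribR cong: if_cong)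
  have "inner_X \<Omega> (lift \<Omega> s r f) (lift \<Omega> s r h)
    = inner_X \<Omega> f (integral_op \<Omega> r s (\<lambda>z y. cnj (of_bool (z \<subseteq> y))) (lift \<Omega> s r h))"
    unfolding lift_def[of \<Omega> s r] by (rule inner_X_integral_op[OF fin])
  also have "\<dots> = ?N * inner_X \<Omega> f h"
    by (simp add: inner_X_L2Xr[OF fin disjI1[OF f_mem]] adjoint_lift sum_distrib_left mult.left_commute)
  finally show ?thesis .
qed

section \<open>Zonal functions\<close>

text \<open>As a function of \<open>z\<close>, with \<open>m = card (z - y)\<close> and \<open>card y = r\<close>, the solution of the recursion
  that harmonicity imposes on \<open>m\<close>, normalised to \<open>1\<close> at \<open>m = 0\<close>.\<close>

definition zonal :: "nat \<Rightarrow> nat \<Rightarrow> nat \<Rightarrow> nat \<Rightarrow> complex" where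
  "zonal n s r m = (-1) ^ m * fact (r - s + m) * fact (n - r - m) / (fact (r - s) * fact (n - r))"

definition zonal_function :: "'a set \<Rightarrow> nat \<Rightarrow> 'a set \<Rightarrow> 'a set \<Rightarrow> complex" where
  "zonal_function \<Omega> s y = (\<lambda>z. if z \<in> Xr \<Omega> s then zonal (card \<Omega>) s (card y) (card (z - y)) else 0)"

definition zonal_op :: "'a set \<Rightarrow> nat \<Rightarrow> nat \<Rightarrow> ('a set \<Rightarrow> complex) \<Rightarrow> 'a set \<Rightarrow> complex" where
  "zonal_op \<Omega> s r = integral_op \<Omega> r s (\<lambda>z y. zonal (card \<Omega>) s r (card (z - y)))"

lemma zonal_0 [simp]: "zonal n s r 0 = 1"
  by (simp add: zonal_def)

lemma cnj_zonal [simp]: "cnj (zonal n s r m) = zonal n s r m"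
  by (simp add: zonal_def)

lemma zonal_recursion:
  assumes "m < n - r"
  shows "of_nat (Suc (r - s + m)) * zonal n s r m + of_nat (n - r - m) * zonal n s r (Suc m) = 0"
proof -
  have "fact (n - r - m) = (of_nat (n - r - m) * fact (n - r - Suc m) :: complex)"
    using assms by (subst fact_reduce) simp_all
  then show ?thesis
    unfolding zonal_def add_Suc_right fact_Suc by (simp add: mult_ac del: of_nat_Suc diff_diff_left)
qed

lemma sum_insert_card_Diff:
  assumes fin: "finite \<Omega>" and "u \<subseteq> \<Omega>" "y \<subseteq> \<Omega>"
  shows "(\<Sum>a\<in>\<Omega> - u. \<phi> (card (insert a u - y))) = of_nat (card (y - u)) * \<phi> (card (u - y))
    + of_nat (card (\<Omega> - u - y)) * (\<phi> (Suc (card (u - y))) :: 'b :: comm_semiring_1)"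
proof -
  have "finite u" using assms by (blast intro: finite_subset)
  have "(\<Sum>a\<in>\<Omega> - u. \<phi> (card (insert a u - y)))
    = (\<Sum>a\<in>(\<Omega> - u) \<inter> y. \<phi> (card (insert a u - y))) + (\<Sum>a\<in>\<Omega> - u - y. \<phi> (card (insert a u - y)))"
    using fin by (intro sum.Int_Diff) simp
  also have "(\<Sum>a\<in>(\<Omega> - u) \<inter> y. \<phi> (card (insert a u - y))) = (\<Sum>a\<in>(\<Omega> - u) \<inter> y. \<phi> (card (u - y)))"
    by (intro sum.cong refl) (simp add: insert_Diff_if)
  also have "(\<Sum>a\<in>\<Omega> - u - y. \<phi> (card (insert a u - y))) = (\<Sum>a\<in>\<Omega> - u - y. \<phi> (Suc (card (u - y))))"
    using \<open>finite u\<close> by (intro sum.cong refl) (simp add: insert_Diff_if)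
  also have "(\<Omega> - u) \<inter> y = y - u" using \<open>y \<subseteq> \<Omega>\<close> by blast
  finally show ?thesis by simp
qed

lemma zonal_function_harmonic:
  assumes fin: "finite \<Omega>" and y_mem: "y \<in> Xr \<Omega> r" and bounds: "s \<le> r" "r + s \<le> card \<Omega>"
  shows "zonal_function \<Omega> s y \<in> harmonic \<Omega> s"
  unfolding harmonic_def
proof (intro CollectI conjI allI impI)
  show "zonal_function \<Omega> s y \<in> L2Xr \<Omega> s" by (simp add: L2Xr_def zonal_function_def)
  fix u assume "u \<subseteq> \<Omega> \<and> Suc (card u) = s"
  then have u_sub: "u \<subseteq> \<Omega>" and u_card: "Suc (card u) = s" by auto
  have y_sub: "y \<subseteq> \<Omega>" and y_card: "card y = r" using y_mem by (auto simp: Xr_def)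
  have fin_u: "finite u" using u_sub fin by (rule finite_subset)
  let ?m = "card (u - y)"
  have "card (u \<inter> y) + ?m = card u" using card_Int_Diff[OF fin_u, of y] by simp
  then have inside: "card (y - u) = Suc (r - s + ?m)" and "?m < card \<Omega> - r"
    using card_Int_Diff_Xr[OF fin y_mem, of u] u_card bounds by (simp_all add: Int_commute)
  have "\<Omega> - u - y = \<Omega> - y - (u - y)" by blast
  then have outside: "card (\<Omega> - u - y) = card \<Omega> - r - ?m"
    using u_sub y_sub y_card fin_u finite_subset[OF y_sub fin] by (simp add: card_Diff_subset Diff_mono)
  have "(\<Sum>a\<in>\<Omega> - u. zonal_function \<Omega> s y (insert a u))
    = (\<Sum>a\<in>\<Omega> - u. zonal (card \<Omega>) s r (card (insert a u - y)))"
    using u_sub u_card fin_u by (intro sum.cong refl) (simp add: zonal_function_def y_card Xr_def)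
  also have "\<dots> = 0"
    unfolding sum_insert_card_Diff[OF fin u_sub y_sub] inside outside
    by (rule zonal_recursion[OF \<open>?m < card \<Omega> - r\<close>])
  finally show "(\<Sum>a\<in>\<Omega> - u. zonal_function \<Omega> s y (insert a u)) = 0" .
qed

lemma act_zonal_function:
  assumes g_perm: "g permutes \<Omega>"
  shows "act g (zonal_function \<Omega> s y) = zonal_function \<Omega> s (g ` y)"
proof
  fix z
  have "card (inv g ` z - y) = card (z - g ` y)"
    using card_Diff_permutes[OF g_perm, of "inv g ` z" y] by (simp add: permutes_image_inv[OF g_perm])
  moreover have "card (g ` y) = card y"
    by (rule card_image[OF inj_on_subset[OF permutes_inj[OF g_perm]]]) simp
  ultimately show "act g (zonal_function \<Omega> s y) z = zonal_function \<Omega> s (g ` y) z"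
    by (simp add: act_def zonal_function_def permutes_image_Xr_iff[OF permutes_inv[OF g_perm]])
qed

lemma zonal_op_eq_sum: "zonal_op \<Omega> s r f = (\<lambda>z. \<Sum>y\<in>Xr \<Omega> r. f y * zonal_function \<Omega> s y z)"
proof
  fix z
  have "(\<Sum>y\<in>Xr \<Omega> r. f y * zonal_function \<Omega> s y z)
    = (\<Sum>y\<in>Xr \<Omega> r. if z \<in> Xr \<Omega> s then zonal (card \<Omega>) s r (card (z - y)) * f y else 0)"
    by (intro sum.cong refl) (simp add: zonal_function_def Xr_def)
  then show "zonal_op \<Omega> s r f z = (\<Sum>y\<in>Xr \<Omega> r. f y * zonal_function \<Omega> s y z)"
    by (simp add: zonal_op_def integral_op_def)
qed

lemma zonal_op_harmonic:
  assumes "finite \<Omega>" "s \<le> r" "r + s \<le> card \<Omega>"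
  shows "zonal_op \<Omega> s r f \<in> harmonic \<Omega> s"
  unfolding zonal_op_eq_sum
  using assms by (intro csubspace_sum G_subspaceD(1)[OF G_subspace_harmonic] zonal_function_harmonic)

lemma G_hom_zonal_op: "G_hom \<Omega> V (zonal_op \<Omega> s r)"
  unfolding zonal_op_def by (intro G_hom_integral_op) (simp add: card_Diff_permutes)

lemma sum_choose_mult_choose:
  "(\<Sum>j\<le>s. ((a + j) choose j) * ((b + (s - j)) choose (s - j))) = (a + b + s + 1) choose s"
proof -
  have negate: "(of_nat ((c + k) choose k) :: rat) = (-1) ^ k * (- of_nat (c + 1) gchoose k)" for c k
    unfolding gbinomial_minus[of "of_nat (c + 1)"] binomial_gbinomial by simp
  have "(of_nat (\<Sum>j\<le>s. ((a + j) choose j) * ((b + (s - j)) choose (s - j))) :: rat)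
    = (\<Sum>j\<le>s. (-1) ^ s * ((- of_nat (a + 1) gchoose j) * (- of_nat (b + 1) gchoose (s - j))))"
    unfolding of_nat_sum of_nat_mult negate
    by (intro sum.cong refl) (simp add: mult_ac flip: power_add)
  also have "\<dots> = (-1) ^ s * ((- of_nat (a + 1) + - of_nat (b + 1)) gchoose s)"
    by (simp only: sum_distrib_left[symmetric] gbinomial_Vandermonde atMost_atLeast0)
  also have "\<dots> = of_nat ((a + b + 1 + s) choose s)"
    unfolding negate by simp
  finally show ?thesis by (simp only: of_nat_eq_iff add_ac)
qed

lemma sum_binomial_zonal:
  assumes "s \<le> r" "r + s \<le> n"
  shows "(\<Sum>j\<le>s. (-1) ^ j * of_nat (s choose j) * zonal n s r j)
    = of_nat ((n - s + 1) choose s) / of_nat ((n - r) choose s)"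
proof -
  define a where "a = r - s"
  define b where "b = n - r - s"
  have sizes: "n - r = b + s" "n - s + 1 = a + b + s + 1" using assms by (simp_all add: a_def b_def)
  have "(-1) ^ j * of_nat (s choose j) * zonal n s r j
    = of_nat (((a + j) choose j) * ((b + (s - j)) choose (s - j))) / of_nat ((b + s) choose s)"
    if "j \<le> s" for j
  proof -
    have "n - r - j = b + (s - j)" using sizes that by simp
    then have zonal_j:
      "zonal n s r j = (-1) ^ j * fact (a + j) * fact (b + (s - j)) / (fact a * fact (b + s))"
      by (simp add: zonal_def a_def sizes(1)[symmetric])
    show ?thesis unfolding zonal_j using that by (simp add: binomial_fact field_simps)
  qed
  then have "(\<Sum>j\<le>s. (-1) ^ j * of_nat (s choose j) * zonal n s r j)
    = of_nat (\<Sum>j\<le>s. ((a + j) choose j) * ((b + (s - j)) choose (s - j))) / of_nat ((b + s) choose s)"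
    by (simp add: sum_divide_distrib)
  then show ?thesis by (simp only: sum_choose_mult_choose sizes)
qed

lemma inner_X_zonal_op:
  assumes fin: "finite \<Omega>" and h_harm: "h \<in> harmonic \<Omega> s" and bounds: "s \<le> r" "r + s \<le> card \<Omega>"
  shows "inner_X \<Omega> (zonal_op \<Omega> s r f) h
    = of_nat ((card \<Omega> - s + 1) choose s) / of_nat ((card \<Omega> - r) choose s) * inner_X \<Omega> f (lift \<Omega> s r h)"
proof -
  let ?c = "of_nat ((card \<Omega> - s + 1) choose s) / of_nat ((card \<Omega> - r) choose s) :: complex"
  have "integral_op \<Omega> s r (\<lambda>y z. cnj (zonal (card \<Omega>) s r (card (z - y)))) h = (\<lambda>y. ?c * lift \<Omega> s r h y)"
  proof
    fix y
    show "integral_op \<Omega> s r (\<lambda>y z. cnj (zonal (card \<Omega>) s r (card (z - y)))) h y = ?c * lift \<Omega> s r h y"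
    proof (cases "y \<in> Xr \<Omega> r")
      case True
      then show ?thesis
        by (simp only: integral_op_def if_True cnj_zonal sum_shell_kernel_harmonic[OF fin h_harm True]
            sum_binomial_zonal[OF bounds])
    qed (simp add: integral_op_def lift_def)
  qed
  then have "inner_X \<Omega> (zonal_op \<Omega> s r f) h = inner_X \<Omega> f (\<lambda>y. ?c * lift \<Omega> s r h y)"
    by (simp only: zonal_op_def inner_X_integral_op[OF fin])
  then show ?thesis by (simp add: inner_X_def sum_distrib_left sum_divide_distrib mult_ac)
qed

definition specht_dim :: "nat \<Rightarrow> nat \<Rightarrow> complex" where
  "specht_dim n s = of_int (ichoose n (int s) - ichoose n (int s - 1))"

lemma specht_dim_eq:
  assumes "2 * s \<le> n"
  shows "specht_dim n s = of_nat (n - 2 * s + 1) * fact n / (fact s * fact (n - s + 1))"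
proof (cases s)
  case 0
  then show ?thesis by (simp add: specht_dim_def ichoose_def del: of_nat_Suc)
next
  case (Suc t)
  have "specht_dim n s = of_nat (n choose s) - of_nat (n choose t)"
    by (simp add: specht_dim_def ichoose_def Suc nat_add_distrib)
  also have "\<dots> = fact n / (fact s * fact (n - s)) - fact n / (fact t * fact (n - t))"
    using assms Suc by (simp add: binomial_fact)
  also have "n - t = Suc (n - s)" using assms Suc by simp
  also have "fact n / (fact s * fact (n - s)) - fact n / (fact t * fact (Suc (n - s)))
    = (of_nat (Suc (n - s)) - of_nat s) * fact n / (fact s * fact (Suc (n - s)) :: complex)"
    by (simp add: Suc field_simps del: of_nat_Suc)
  also have "of_nat (Suc (n - s)) - of_nat s = (of_nat (n - 2 * s + 1) :: complex)"
    using assms by (simp add: of_nat_diff)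
  finally show ?thesis by simp
qed

definition zonal_eigenvalue :: "nat \<Rightarrow> nat \<Rightarrow> nat \<Rightarrow> complex" where
  "zonal_eigenvalue n s r = of_nat (r choose s) * of_nat (n choose r) / specht_dim n s"

lemma zonal_eigenvalue_neq_0:
  assumes "s \<le> r" "r + s \<le> n"
  shows "zonal_eigenvalue n s r \<noteq> 0"
  using assms by (simp add: zonal_eigenvalue_def specht_dim_eq del: of_nat_Suc)

lemma zonal_eigenvalue_eq:
  assumes "s \<le> r" "r + s \<le> n"
  shows "zonal_eigenvalue n s r
    = of_nat ((n - s + 1) choose s) / of_nat ((n - r) choose s) * of_nat ((n - 2 * s) choose (r - s))"
proof -
  define u where "u = r - s"
  define v where "v = n - r - s"
  have sizes: "r = u + s" "n - r = v + s" "n - s + 1 = Suc (u + v) + s" "r - s = u" "n - 2 * s = u + v"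
    using assms by (simp_all add: u_def v_def)
  have binomials:
    "of_nat ((Suc (u + v) + s) choose s)
      = (fact (Suc (u + v) + s) / (fact s * fact (Suc (u + v))) :: complex)"
    "of_nat ((v + s) choose s) = (fact (v + s) / (fact s * fact v) :: complex)"
    "of_nat ((u + v) choose u) = (fact (u + v) / (fact u * fact v) :: complex)"
    "of_nat ((u + s) choose s) = (fact (u + s) / (fact s * fact u) :: complex)"
    by (simp_all only: binomial_fact le_add1 le_add2 add_diff_cancel_left' add_diff_cancel_right')
  have choose_r: "of_nat (n choose r) = (fact n / (fact r * fact (v + s)) :: complex)"
    using assms by (simp add: binomial_fact sizes(2))
  have "2 * s \<le> n" using assms by simp
  then have dim: "specht_dim n s = of_nat (Suc (u + v)) * fact n / (fact s * fact (Suc (u + v) + s))"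
    by (simp only: specht_dim_eq sizes(3,5) Suc_eq_plus1)
  have "of_nat (Suc (u + v)) \<noteq> (0 :: complex)" by (rule of_nat_neq_0)
  then show ?thesis
    unfolding zonal_eigenvalue_def dim choose_r sizes(2-5) binomials(1-3)
    unfolding sizes(1) binomials(4) fact_Suc[of "u + v"]
    by (simp add: field_simps del: of_nat_Suc of_nat_add fact_Suc add_Suc)
qed

lemma zonal_op_lift:
  assumes fin: "finite \<Omega>" and f_harm: "f \<in> harmonic \<Omega> s" and bounds: "s \<le> r" "r + s \<le> card \<Omega>"
  shows "zonal_op \<Omega> s r (lift \<Omega> s r f) = (\<lambda>z. zonal_eigenvalue (card \<Omega>) s r * f z)"
proof -
  let ?e = "zonal_eigenvalue (card \<Omega>) s r" and ?T = "zonal_op \<Omega> s r (lift \<Omega> s r f)"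
  define d where "d = (\<lambda>z. ?T z + - ?e * f z)"
  have d_harm: "d \<in> harmonic \<Omega> s"
    unfolding d_def by (intro G_subspaceD[OF G_subspace_harmonic] zonal_op_harmonic[OF fin bounds] f_harm)
  have "inner_X \<Omega> ?T d = ?e * inner_X \<Omega> f d"
    by (simp only: inner_X_zonal_op[OF fin d_harm bounds] zonal_eigenvalue_eq[OF bounds] mult.assoc
        inner_X_lift_lift[OF fin harmonicD(1)[OF f_harm] d_harm bounds(1)])
  moreover have "inner_X \<Omega> d d = inner_X \<Omega> ?T d - ?e * inner_X \<Omega> f d"
    by (subst (1) d_def)
       (simp add: inner_X_def left_diff_distrib sum_subtractf sum_distrib_left mult.assoc)
  ultimately have "inner_X \<Omega> d d = 0" by simp
  then have "d = (\<lambda>_. 0)" using inner_X_self_eq_0_iff[OF fin harmonicD(1)[OF d_harm]] by simp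
  then show ?thesis by (auto simp: d_def fun_eq_iff)
qed

lemma harmonic_eq_sum_zonal_function:
  assumes fin: "finite \<Omega>" and f_harm: "f \<in> harmonic \<Omega> s" and "2 * s \<le> card \<Omega>"
  shows "f = (\<lambda>z. \<Sum>w\<in>Xr \<Omega> s. (f w / zonal_eigenvalue (card \<Omega>) s s) * zonal_function \<Omega> s w z)"
proof -
  have bounds: "s \<le> s" "s + s \<le> card \<Omega>" using assms(3) by simp_all
  have "zonal_op \<Omega> s s f = (\<lambda>z. zonal_eigenvalue (card \<Omega>) s s * f z)"
    using zonal_op_lift[OF fin f_harm bounds] by (simp add: lift_same[OF fin harmonicD(1)[OF f_harm]])
  then show ?thesis
    using zonal_eigenvalue_neq_0[OF bounds]
    by (simp add: zonal_op_eq_sum fun_eq_iff flip: sum_divide_distrib)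
qed

definition stabilizer :: "'a set \<Rightarrow> 'a set \<Rightarrow> ('a \<Rightarrow> 'a) set" where
  "stabilizer \<Omega> y = {g. g permutes \<Omega> \<and> g ` y = y}"

lemma harmonic_invariant_eq_zonal_function:
  assumes fin: "finite \<Omega>" and f_harm: "f \<in> harmonic \<Omega> s" and half: "2 * s \<le> card \<Omega>"
    and y_mem: "y \<in> Xr \<Omega> s" and inv: "\<And>g. g \<in> stabilizer \<Omega> y \<Longrightarrow> act g f = f"
  shows "f = (\<lambda>z. f y * zonal_function \<Omega> s y z)"
proof -
  have y_card: "card y = s" using y_mem by (simp add: Xr_def)
  define h where "h = (\<lambda>z. f z + - f y * zonal_function \<Omega> s y z)"
  have h_harm: "h \<in> harmonic \<Omega> s"
    unfolding h_def using half
    by (intro G_subspaceD[OF G_subspace_harmonic] f_harm zonal_function_harmonic[OF fin y_mem]) auto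
  have "h w = h z"
    if w_mem: "w \<in> Xr \<Omega> s" and z_mem: "z \<in> Xr \<Omega> s" and eq: "card (w - y) = card (z - y)" for w z
  proof -
    obtain g where g_perm: "g permutes \<Omega>" and images: "g ` y = y" "g ` w = z"
      by (rule permutes_pair_transitive[OF fin y_mem y_mem w_mem z_mem eq])
    then have "act g f = f" by (intro inv) (simp add: stabilizer_def)
    then have "f z = f w" using g_perm images by (metis act_def permutes_image_inv(2))
    then show ?thesis using w_mem z_mem eq by (simp add: h_def zonal_function_def y_card)
  qed
  moreover have "lift \<Omega> s s h y = 0"
    using y_mem
    by (simp add: lift_same[OF fin harmonicD(1)[OF h_harm]]) (simp add: h_def zonal_function_def)
  ultimately have h_zero: "h = (\<lambda>_. 0)" by (rule harmonic_eq_0I[OF fin h_harm y_mem])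
  show ?thesis
  proof
    fix z
    have "f z + - f y * zonal_function \<Omega> s y z = 0" using fun_cong[OF h_zero, of z] by (simp only: h_def)
    then show "f z = f y * zonal_function \<Omega> s y z"
      by (simp only: mult_minus_left add_uminus_conv_diff right_minus_eq)
  qed
qed

section \<open>Irreducibility of the harmonic functions\<close>

lemma stabilizer_compose:
  assumes "g \<in> stabilizer \<Omega> y" "h \<in> stabilizer \<Omega> y"
  shows "g \<circ> h \<in> stabilizer \<Omega> y"
proof -
  have "(g \<circ> h) ` y = g ` (h ` y)" by (rule image_comp[symmetric])
  then show ?thesis using assms by (simp add: stabilizer_def permutes_compose del: image_comp)
qed

lemma stabilizer_inv:
  assumes "g \<in> stabilizer \<Omega> y"
  shows "inv g \<in> stabilizer \<Omega> y"
proof -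
  have g_perm: "g permutes \<Omega>" and "g ` y = y" using assms by (simp_all add: stabilizer_def)
  then have "inv g ` y = y" using permutes_image_inv(2)[OF g_perm, of y] by (simp only:)
  then show ?thesis using permutes_inv[OF g_perm] by (simp add: stabilizer_def)
qed

lemma act_compose:
  assumes "g permutes \<Omega>" "h permutes \<Omega>"
  shows "act (g \<circ> h) f = act g (act h f)"
  unfolding act_def o_inv_distrib[OF assms[THEN permutes_bij]] image_comp ..

lemma G_subspace_stabilizer_average:
  assumes fin: "finite \<Omega>" and W_sub: "G_subspace \<Omega> W" and f_mem: "f \<in> W"
  obtains h where "h \<in> W" "h y = f y" "\<And>g. g \<in> stabilizer \<Omega> y \<Longrightarrow> act g h = h"
proof
  let ?S = "stabilizer \<Omega> y"
  let ?h = "\<lambda>x. \<Sum>g\<in>?S. inverse (of_nat (card ?S)) * act g f x"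
  have "id \<in> ?S" by (simp add: stabilizer_def permutes_id)
  moreover have "finite ?S" using finite_permutations[OF fin] by (simp add: stabilizer_def)
  ultimately have "card ?S \<noteq> 0" by auto
  show "?h \<in> W"
    using f_mem by (intro csubspace_sum G_subspaceD[OF W_sub]) (simp add: stabilizer_def)
  have "act g f y = f y" if "g \<in> ?S" for g
    using stabilizer_inv[OF that] by (simp add: act_def stabilizer_def)
  then show "?h y = f y" using \<open>card ?S \<noteq> 0\<close> by simp
  fix k assume k_mem: "k \<in> ?S"
  have "(\<Sum>g\<in>?S. act k (act g f) x) = (\<Sum>g\<in>?S. act g f x)" for x
  proof (rule sum.reindex_bij_witness[of _ "\<lambda>g. inv k \<circ> g" "\<lambda>g. k \<circ> g"])
    have "k permutes \<Omega>" using k_mem by (simp add: stabilizer_def)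
    note inverses = permutes_inv_o[OF this]
    fix g assume g_mem: "g \<in> ?S"
    show "inv k \<circ> (k \<circ> g) = g" "k \<circ> (inv k \<circ> g) = g"
      by (simp_all add: o_assoc inverses)
    show "k \<circ> g \<in> ?S" "inv k \<circ> g \<in> ?S"
      using k_mem g_mem by (simp_all add: stabilizer_compose stabilizer_inv)
    show "act (k \<circ> g) f x = act k (act g f) x"
      using k_mem g_mem act_compose[of k \<Omega> g f] by (simp add: stabilizer_def)
  qed
  then show "act k ?h = ?h"
    by (simp add: act_def fun_eq_iff flip: sum_distrib_left)
qed

lemma G_subspace_harmonic_eq:
  assumes fin: "finite \<Omega>" and half: "2 * s \<le> card \<Omega>"
    and W_sub: "G_subspace \<Omega> W" "W \<subseteq> harmonic \<Omega> s" and "W \<noteq> {\<lambda>_. 0}"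
  shows "W = harmonic \<Omega> s"
proof
  obtain f where f_mem: "f \<in> W" and "f \<noteq> (\<lambda>_. 0)"
    using \<open>W \<noteq> {\<lambda>_. 0}\<close> G_subspaceD(2)[OF W_sub(1)] by blast
  then obtain y where "f y \<noteq> 0" by blast
  then have y_mem: "y \<in> Xr \<Omega> s" using harmonicD(1) f_mem W_sub(2) by (force simp: L2Xr_def)
  obtain h where h_mem: "h \<in> W" and "h y = f y" and h_inv: "\<And>g. g \<in> stabilizer \<Omega> y \<Longrightarrow> act g h = h"
    by (rule G_subspace_stabilizer_average[OF fin W_sub(1) f_mem, of y]) (rule that)
  then have "h = (\<lambda>z. f y * zonal_function \<Omega> s y z)"
    using harmonic_invariant_eq_zonal_function[OF fin _ half y_mem h_inv] W_sub(2) by auto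
  then have "zonal_function \<Omega> s y = (\<lambda>z. inverse (f y) * h z)" using \<open>f y \<noteq> 0\<close> by simp
  then have zonal_y: "zonal_function \<Omega> s y \<in> W" using G_subspaceD(4)[OF W_sub(1) h_mem] by simp
  have zonal_mem: "zonal_function \<Omega> s w \<in> W" if w_mem: "w \<in> Xr \<Omega> s" for w
  proof -
    obtain g where g_perm: "g permutes \<Omega>" and "g ` y = w"
      by (rule permutes_pair_transitive[OF fin y_mem w_mem y_mem w_mem]) auto
    then show ?thesis using G_subspaceD(5)[OF W_sub(1) g_perm zonal_y] by (simp add: act_zonal_function)
  qed
  show "harmonic \<Omega> s \<subseteq> W"
  proof
    fix f assume f_harm: "f \<in> harmonic \<Omega> s"
    show "f \<in> W"
      by (subst harmonic_eq_sum_zonal_function[OF fin f_harm half])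
         (intro csubspace_sum G_subspaceD(1)[OF W_sub(1)] zonal_mem)
  qed
qed (rule W_sub(2))

lemma G_irreducible_harmonic:
  assumes fin: "finite \<Omega>" and half: "2 * s \<le> card \<Omega>"
  shows "G_irreducible \<Omega> (harmonic \<Omega> s)"
proof -
  obtain y where y_mem: "y \<in> Xr \<Omega> s"
    using obtain_subset_with_card_n[of s \<Omega>] half by (auto simp: Xr_def)
  then have "zonal_function \<Omega> s y \<in> harmonic \<Omega> s"
    using half by (intro zonal_function_harmonic[OF fin y_mem]) auto
  moreover have "zonal_function \<Omega> s y y = 1" using y_mem by (simp add: zonal_function_def)
  ultimately have "harmonic \<Omega> s \<noteq> {\<lambda>_. 0}" by force
  then show ?thesis
    using G_subspace_harmonic G_subspace_harmonic_eq[OF fin half] by (auto simp: G_irreducible_def)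
qed

lemma invariant_kernel_eq_shell_kernel:
  assumes fin: "finite \<Omega>"
    and inv: "\<And>g w x. g permutes \<Omega> \<Longrightarrow> w \<in> Xr \<Omega> s \<Longrightarrow> x \<in> Xr \<Omega> r \<Longrightarrow> k (g ` w) (g ` x) = k w x"
  obtains \<phi> where "\<And>w x. w \<in> Xr \<Omega> s \<Longrightarrow> x \<in> Xr \<Omega> r \<Longrightarrow> k w x = \<phi> (card (w - x))"
proof -
  define pair where "pair = (\<lambda>j. SOME p. fst p \<in> Xr \<Omega> s \<and> snd p \<in> Xr \<Omega> r \<and> card (fst p - snd p) = j)"
  have "k w x = k (fst (pair (card (w - x)))) (snd (pair (card (w - x))))"
    if w_mem: "w \<in> Xr \<Omega> s" and x_mem: "x \<in> Xr \<Omega> r" for w x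
  proof -
    let ?p = "pair (card (w - x))"
    have pair: "fst ?p \<in> Xr \<Omega> s \<and> snd ?p \<in> Xr \<Omega> r \<and> card (fst ?p - snd ?p) = card (w - x)"
      unfolding pair_def by (rule someI[of _ "(w, x)"]) (simp add: w_mem x_mem)
    then obtain g where "g permutes \<Omega>" "g ` snd ?p = x" "g ` fst ?p = w"
      using permutes_pair_transitive[OF fin _ x_mem _ w_mem] by blast
    then show ?thesis using inv pair by metis
  qed
  then show ?thesis by (rule that)
qed

lemma G_hom_harmonic_eq_lift:
  assumes fin: "finite \<Omega>" and half: "2 * s \<le> card \<Omega>"
    and T_hom: "G_hom \<Omega> (harmonic \<Omega> s) T" and T_image: "T ` harmonic \<Omega> s \<subseteq> L2Xr \<Omega> r"
  obtains c where "\<And>f. f \<in> harmonic \<Omega> s \<Longrightarrow> T f = (\<lambda>x. c * lift \<Omega> s r f x)"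
proof -
  let ?e = "zonal_eigenvalue (card \<Omega>) s s"
  have zonal_harm: "zonal_function \<Omega> s w \<in> harmonic \<Omega> s" if "w \<in> Xr \<Omega> s" for w
    using half by (intro zonal_function_harmonic[OF fin that]) auto
  have "T (zonal_function \<Omega> s (g ` w)) (g ` x) = T (zonal_function \<Omega> s w) x"
    if g_perm: "g permutes \<Omega>" and w_mem: "w \<in> Xr \<Omega> s" for g w x
  proof -
    have "T (zonal_function \<Omega> s (g ` w)) = act g (T (zonal_function \<Omega> s w))"
      using G_homD(3)[OF T_hom g_perm zonal_harm[OF w_mem]] by (simp only: act_zonal_function[OF g_perm])
    then show ?thesis by (simp add: act_def permutes_image_inv(2)[OF g_perm])
  qed
  then obtain \<phi> where
    shell: "\<And>w x. w \<in> Xr \<Omega> s \<Longrightarrow> x \<in> Xr \<Omega> r \<Longrightarrow> T (zonal_function \<Omega> s w) x = \<phi> (card (w - x))"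
    using invariant_kernel_eq_shell_kernel[OF fin, of s r "\<lambda>w. T (zonal_function \<Omega> s w)"] by blast
  define c where "c = (\<Sum>j\<le>s. (-1) ^ j * of_nat (s choose j) * \<phi> j) / ?e"
  have "T f x = c * lift \<Omega> s r f x" if f_harm: "f \<in> harmonic \<Omega> s" for f x
  proof (cases "x \<in> Xr \<Omega> r")
    case True
    have "T f = T (\<lambda>z. \<Sum>w\<in>Xr \<Omega> s. (f w / ?e) * zonal_function \<Omega> s w z)"
      using harmonic_eq_sum_zonal_function[OF fin f_harm half] by (rule arg_cong)
    also have "\<dots> = (\<lambda>z. \<Sum>w\<in>Xr \<Omega> s. (f w / ?e) * T (zonal_function \<Omega> s w) z)"
      by (rule G_hom_sum[OF T_hom G_subspaceD(1)[OF G_subspace_harmonic] zonal_harm])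
    finally have "T f x = (\<Sum>w\<in>Xr \<Omega> s. \<phi> (card (w - x)) * f w) / ?e"
      by (simp add: shell[OF _ True] sum_divide_distrib mult.commute)
    then show ?thesis
      by (simp add: sum_shell_kernel_harmonic[OF fin f_harm True] c_def)
  qed (use T_image f_harm in \<open>auto simp: L2Xr_def lift_def integral_op_def\<close>)
  then show ?thesis by (intro that ext)
qed

section \<open>Polytabloids and the irreducible constituents\<close>

definition columns :: "'a set \<Rightarrow> nat \<Rightarrow> (nat \<Rightarrow> 'a) \<Rightarrow> (nat \<Rightarrow> 'a) \<Rightarrow> bool" where
  "columns \<Omega> s a b \<longleftrightarrow> (\<forall>i<s. a i \<in> \<Omega> \<and> b i \<in> \<Omega>)
     \<and> inj_on (\<lambda>j. if j < s then a j else b (j - s)) {..<2 * s}"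

lemma specht_eq_span: "specht \<Omega> s = cfun.span {polytabloid \<Omega> s a b | a b. columns \<Omega> s a b}"
  by (simp add: specht_def cspan_eq_span columns_def)

lemma polytabloid_in_specht: "columns \<Omega> s a b \<Longrightarrow> polytabloid \<Omega> s a b \<in> specht \<Omega> s"
  unfolding specht_eq_span by (rule cfun.span_base) blast

lemma specht_least:
  assumes "csubspace V" "\<And>a b. columns \<Omega> s a b \<Longrightarrow> polytabloid \<Omega> s a b \<in> V"
  shows "specht \<Omega> s \<subseteq> V"
  unfolding specht_eq_span
proof (rule cfun.span_minimal)
  show "cfun.subspace V" using assms(1) by (simp only: csubspace_iff_subspace)
qed (use assms(2) in blast)

lemma columnsD:
  assumes "columns \<Omega> s a b" "i < s"
  shows "a i \<in> \<Omega>" "b i \<in> \<Omega>"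
    "j < s \<Longrightarrow> a i = a j \<longleftrightarrow> i = j" "j < s \<Longrightarrow> b i = b j \<longleftrightarrow> i = j" "j < s \<Longrightarrow> a i \<noteq> b j"
proof -
  define c where "c = (\<lambda>j. if j < s then a j else b (j - s))"
  have inj: "c p = c q \<longleftrightarrow> p = q" if "p < 2 * s" "q < 2 * s" for p q
    using assms(1) that inj_on_eq_iff[of c "{..<2 * s}" p q] by (simp add: columns_def c_def)
  show "a i \<in> \<Omega>" "b i \<in> \<Omega>" using assms by (simp_all add: columns_def)
  show "a i = a j \<longleftrightarrow> i = j" "b i = b j \<longleftrightarrow> i = j" "a i \<noteq> b j" if "j < s"
    using inj[of i j] inj[of "i + s" "j + s"] inj[of i "j + s"] assms(2) that by (simp_all add: c_def)
qed

lemma columns_permutes: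
  assumes "columns \<Omega> s a b" "g permutes \<Omega>"
  shows "columns \<Omega> s (g \<circ> a) (g \<circ> b)"
proof -
  have "(\<lambda>j. if j < s then (g \<circ> a) j else (g \<circ> b) (j - s)) = g \<circ> (\<lambda>j. if j < s then a j else b (j - s))"
    by auto
  then show ?thesis
    using assms permutes_in_image[OF assms(2)] inj_on_subset[OF permutes_inj[OF assms(2)]]
    by (auto simp: columns_def intro: comp_inj_on)
qed

lemma exists_columns:
  assumes "finite \<Omega>" "2 * s \<le> card \<Omega>"
  obtains a b where "columns \<Omega> s a b"
proof -
  obtain f where "inj_on f {..<2 * s}" "f ` {..<2 * s} \<subseteq> \<Omega>"
    using assms by (metis card_le_inj card_lessThan finite_lessThan)
  moreover have "inj_on (\<lambda>j. if j < s then f j else f (j - s + s)) {..<2 * s} \<longleftrightarrow> inj_on f {..<2 * s}"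
    by (intro inj_on_cong) auto
  ultimately have "columns \<Omega> s f (\<lambda>i. f (i + s))"
    by (auto simp: columns_def image_subset_iff)
  then show ?thesis by (rule that)
qed

lemma exists_column_avoiding:
  assumes cols: "columns \<Omega> s a b" and "finite u" "card u < s"
  obtains i where "i < s" "a i \<notin> u" "b i \<notin> u"
proof -
  have "\<exists>i<s. a i \<notin> u \<and> b i \<notin> u"
  proof (rule ccontr)
    assume no_column: "\<not> ?thesis"
    let ?c = "\<lambda>i. if a i \<in> u then a i else b i"
    have "?c i = ?c j \<longleftrightarrow> i = j" if "i < s" "j < s" for i j
      using columnsD(3-5)[OF cols that] columnsD(5)[OF cols that(2,1)] by auto
    then have "inj_on ?c {..<s}" by (auto simp: inj_on_def simp del: if_split)
    moreover have "?c ` {..<s} \<subseteq> u" using no_column by auto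
    ultimately have "card {..<s} \<le> card u" using \<open>finite u\<close> by (intro card_inj_on_le)
    then show False using \<open>card u < s\<close> by simp
  qed
  then show ?thesis using that by blast
qed

lemma polytabloid_insert_column:
  assumes cols: "columns \<Omega> s a b" and "i < s" "a i \<notin> u" "b i \<notin> u"
    and "finite u" "u \<subseteq> \<Omega>" "Suc (card u) = s"
  shows "polytabloid \<Omega> s a b (insert (a i) u) = - polytabloid \<Omega> s a b (insert (b i) u)"
    "v \<noteq> a i \<Longrightarrow> v \<noteq> b i \<Longrightarrow> polytabloid \<Omega> s a b (insert v u) = 0"
proof -
  let ?sign = "\<lambda>x j. (if a j \<in> x then 1 else 0 :: complex) - (if b j \<in> x then 1 else 0)"
  have "a i \<noteq> b i" using columnsD(5)[OF cols \<open>i < s\<close> \<open>i < s\<close>] .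
  have factor: "(\<Prod>j<s. ?sign x j) = ?sign x i * (\<Prod>j\<in>{..<s} - {i}. ?sign x j)" for x
    using \<open>i < s\<close> by (intro prod.remove) auto
  have "insert (a i) u \<in> Xr \<Omega> s" "insert (b i) u \<in> Xr \<Omega> s"
    using assms columnsD(1,2)[OF cols \<open>i < s\<close>] by (auto simp: Xr_def)
  moreover have "(\<Prod>j\<in>{..<s} - {i}. ?sign (insert (a i) u) j) = (\<Prod>j\<in>{..<s} - {i}. ?sign (insert (b i) u) j)"
  proof (intro prod.cong refl)
    fix j assume "j \<in> {..<s} - {i}"
    then have "a j \<noteq> a i" "a j \<noteq> b i" "b j \<noteq> a i" "b j \<noteq> b i"
      using columnsD(3-5)[OF cols _ \<open>i < s\<close>, of j] columnsD(5)[OF cols \<open>i < s\<close>, of j] by auto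
    then show "?sign (insert (a i) u) j = ?sign (insert (b i) u) j" by simp
  qed
  ultimately show "polytabloid \<Omega> s a b (insert (a i) u) = - polytabloid \<Omega> s a b (insert (b i) u)"
    unfolding polytabloid_def factor using assms(3,4) \<open>a i \<noteq> b i\<close> by simp
  show "polytabloid \<Omega> s a b (insert v u) = 0" if "v \<noteq> a i" "v \<noteq> b i"
    unfolding polytabloid_def factor using that assms(3,4) by auto
qed

lemma polytabloid_harmonic:
  assumes fin: "finite \<Omega>" and cols: "columns \<Omega> s a b"
  shows "polytabloid \<Omega> s a b \<in> harmonic \<Omega> s"
  unfolding harmonic_def
proof (intro CollectI conjI allI impI)
  show "polytabloid \<Omega> s a b \<in> L2Xr \<Omega> s" by (simp add: L2Xr_def polytabloid_def)
  fix u assume "u \<subseteq> \<Omega> \<and> Suc (card u) = s"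
  then have u_sub: "finite u" "u \<subseteq> \<Omega>" "Suc (card u) = s" using finite_subset[OF _ fin] by auto
  obtain i where column: "i < s" "a i \<notin> u" "b i \<notin> u"
    using exists_column_avoiding[OF cols u_sub(1)] u_sub(3) by auto
  note insert_column = polytabloid_insert_column[OF cols column u_sub]
  have "(\<Sum>v\<in>\<Omega> - u. polytabloid \<Omega> s a b (insert v u)) = (\<Sum>v\<in>{a i, b i}. polytabloid \<Omega> s a b (insert v u))"
    using fin column columnsD(1,2)[OF cols column(1)] insert_column(2)
    by (intro sum.mono_neutral_right) auto
  also have "\<dots> = 0"
    using columnsD(5)[OF cols column(1) column(1)] insert_column(1) by simp
  finally show "(\<Sum>v\<in>\<Omega> - u. polytabloid \<Omega> s a b (insert v u)) = 0" .
qed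

lemma act_polytabloid:
  assumes g_perm: "g permutes \<Omega>"
  shows "act g (polytabloid \<Omega> s a b) = polytabloid \<Omega> s (g \<circ> a) (g \<circ> b)"
proof -
  have "c \<in> inv g ` x \<longleftrightarrow> g c \<in> x" for c x
    using bij_vimage_eq_inv_image[OF permutes_bij[OF g_perm], of x] by auto
  then show ?thesis
    by (simp add: act_def polytabloid_def fun_eq_iff permutes_image_Xr_iff[OF permutes_inv[OF g_perm]])
qed

lemma G_subspace_specht: "G_subspace \<Omega> (specht \<Omega> s)"
  unfolding G_subspace_def G_invariant_def
proof (intro conjI allI impI ballI)
  show specht_sub: "csubspace (specht \<Omega> s)" by (simp add: specht_eq_span csubspace_iff_subspace)
  fix g f assume g_perm: "g permutes \<Omega>" and f_mem: "f \<in> specht \<Omega> s"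
  have "specht \<Omega> s \<subseteq> {f. act g f \<in> specht \<Omega> s}"
  proof (rule specht_least)
    show "csubspace {f. act g f \<in> specht \<Omega> s}"
      using specht_sub by (simp add: csubspace_def act_def)
    fix a b assume "columns \<Omega> s a b"
    then show "polytabloid \<Omega> s a b \<in> {f. act g f \<in> specht \<Omega> s}"
      by (simp add: act_polytabloid[OF g_perm] polytabloid_in_specht columns_permutes g_perm)
  qed
  then show "act g f \<in> specht \<Omega> s" using f_mem by blast
qed

lemma specht_eq_harmonic:
  assumes fin: "finite \<Omega>" and half: "2 * s \<le> card \<Omega>"
  shows "specht \<Omega> s = harmonic \<Omega> s"
proof (rule G_subspace_harmonic_eq[OF fin half G_subspace_specht])
  show "specht \<Omega> s \<subseteq> harmonic \<Omega> s"
    by (rule specht_least[OF G_subspaceD(1)[OF G_subspace_harmonic] polytabloid_harmonic[OF fin]])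
  obtain a b where cols: "columns \<Omega> s a b" by (rule exists_columns[OF fin half])
  have "inj_on a {..<s}" using columnsD(3)[OF cols] by (simp add: inj_on_def)
  then have "a ` {..<s} \<in> Xr \<Omega> s"
    using columnsD(1)[OF cols] by (auto simp: Xr_def card_image)
  moreover have "b i \<notin> a ` {..<s}" if "i < s" for i
    using columnsD(5)[OF cols _ that] by force
  ultimately have "polytabloid \<Omega> s a b (a ` {..<s}) = 1"
    by (simp add: polytabloid_def)
  moreover have "polytabloid \<Omega> s a b \<in> specht \<Omega> s"
    by (rule polytabloid_in_specht[OF cols])
  ultimately show "specht \<Omega> s \<noteq> {\<lambda>_. 0}" by force
qed

lemma inj_on_lift_harmonic:
  assumes fin: "finite \<Omega>" and bounds: "s \<le> r" "r + s \<le> card \<Omega>"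
  shows "inj_on (lift \<Omega> s r) (harmonic \<Omega> s)"
proof (rule inj_onI)
  fix f h assume "f \<in> harmonic \<Omega> s" "h \<in> harmonic \<Omega> s" "lift \<Omega> s r f = lift \<Omega> s r h"
  then have "(\<lambda>z. zonal_eigenvalue (card \<Omega>) s r * f z) = (\<lambda>z. zonal_eigenvalue (card \<Omega>) s r * h z)"
    by (simp only: zonal_op_lift[OF fin _ bounds, symmetric])
  then show "f = h" using zonal_eigenvalue_neq_0[OF bounds] by (auto simp: fun_eq_iff)
qed

lemma G_irreducible_lift_harmonic:
  assumes fin: "finite \<Omega>" and bounds: "s \<le> r" "r + s \<le> card \<Omega>"
  shows "G_irreducible \<Omega> (lift \<Omega> s r ` harmonic \<Omega> s)"
  using bounds by (intro G_irreducible_image G_irreducible_harmonic[OF fin] G_hom_lift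
      inj_on_lift_harmonic[OF fin]) auto

lemma G_isomorphic_specht_imp_eq:
  assumes fin: "finite \<Omega>" and bounds: "s \<le> r" "r + s \<le> card \<Omega>"
    and "V \<subseteq> L2Xr \<Omega> r" and V_irred: "G_irreducible \<Omega> V" and iso: "G_isomorphic \<Omega> V (specht \<Omega> s)"
  shows "V = lift \<Omega> s r ` harmonic \<Omega> s"
proof -
  let ?H = "harmonic \<Omega> s"
  have half: "2 * s \<le> card \<Omega>" using bounds by simp
  have V_sub: "G_subspace \<Omega> V" and "V \<noteq> {\<lambda>_. 0}" using V_irred by (simp_all add: G_irreducible_def)
  obtain T where "T ` ?H = V" and T_hom: "G_hom \<Omega> ?H T"
    using G_isomorphic_sym[OF V_sub iso]
    by (auto simp: G_isomorphic_iff bij_betw_def specht_eq_harmonic[OF fin half])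
  then obtain c where T_eq: "\<And>f. f \<in> ?H \<Longrightarrow> T f = (\<lambda>x. c * lift \<Omega> s r f x)"
    using G_hom_harmonic_eq_lift[OF fin half T_hom] \<open>V \<subseteq> L2Xr \<Omega> r\<close> by blast
  have "T f \<in> lift \<Omega> s r ` ?H" if "f \<in> ?H" for f
    unfolding T_eq[OF that]
    by (intro G_subspaceD(4)[OF G_subspace_image[OF G_subspace_harmonic G_hom_lift]] imageI that)
  then have "V \<subseteq> lift \<Omega> s r ` ?H" using \<open>T ` ?H = V\<close> by blast
  then show ?thesis
    using V_sub \<open>V \<noteq> {\<lambda>_. 0}\<close> G_irreducible_lift_harmonic[OF fin bounds]
    unfolding G_irreducible_def by blast
qed

lemma L2Xrs_eq_lift_harmonic:
  assumes fin: "finite \<Omega>" and bounds: "s \<le> r" "r + s \<le> card \<Omega>"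
  shows "L2Xrs \<Omega> r s = lift \<Omega> s r ` harmonic \<Omega> s"
  unfolding L2Xrs_def
proof (rule the_equality)
  let ?V = "lift \<Omega> s r ` harmonic \<Omega> s"
  have "G_isomorphic \<Omega> (harmonic \<Omega> s) ?V"
    unfolding G_isomorphic_iff
    by (intro exI[of _ "lift \<Omega> s r"])
       (simp add: bij_betw_def inj_on_lift_harmonic[OF fin bounds] G_hom_lift)
  then have "G_isomorphic \<Omega> ?V (specht \<Omega> s)"
    using G_isomorphic_sym[OF G_subspace_harmonic] specht_eq_harmonic[OF fin] bounds by simp
  moreover have "?V \<subseteq> L2Xr \<Omega> r" using integral_op_L2Xr by (auto simp: lift_def)
  ultimately show "?V \<subseteq> L2Xr \<Omega> r \<and> G_irreducible \<Omega> ?V \<and> G_isomorphic \<Omega> ?V (specht \<Omega> s)"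
    using G_irreducible_lift_harmonic[OF fin bounds] by blast
qed (use G_isomorphic_specht_imp_eq[OF fin bounds] in blast)

section \<open>The polynomial kernels\<close>

definition choose_poly :: "nat \<Rightarrow> complex poly" where
  "choose_poly m = smult (inverse (fact m)) (\<Prod>i<m. [:- of_nat i, 1:])"

lemma poly_choose_poly: "poly (choose_poly m) (of_nat k) = of_nat (k choose m)"
  by (simp add: choose_poly_def poly_prod binomial_gbinomial gbinomial_prod_rev field_simps atLeast0LessThan)

lemma degree_choose_poly: "degree (choose_poly m) = m"
  unfolding choose_poly_def by (simp add: degree_prod_eq_sum_degree)

lemma coeff_choose_poly_degree: "coeff (choose_poly m) m = inverse (fact m)"
proof -
  have "lead_coeff (choose_poly m) = inverse (fact m)"
    unfolding choose_poly_def lead_coeff_smult lead_coeff_prod by simp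
  then show ?thesis by (simp only: degree_choose_poly)
qed

text \<open>At \<open>card (x - y)\<close> this counts the \<open>s\<close>-subsets \<open>z\<close> of an \<open>r\<close>-set \<open>x\<close> with \<open>card (z - y) = m\<close>.\<close>

definition shell_poly :: "nat \<Rightarrow> nat \<Rightarrow> nat \<Rightarrow> complex poly" where
  "shell_poly r s m = choose_poly m * (choose_poly (s - m) \<circ>\<^sub>p [:of_nat r, -1:])"

lemma poly_shell_poly:
  assumes "k \<le> r"
  shows "poly (shell_poly r s m) (of_nat k) = of_nat ((k choose m) * ((r - k) choose (s - m)))"
  using poly_choose_poly[of "s - m" "r - k"] assms
  by (simp add: shell_poly_def poly_pcompose poly_choose_poly of_nat_diff)

lemma degree_shell_poly:
  assumes "m \<le> s"
  shows "degree (shell_poly r s m) = s"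
proof -
  have "choose_poly j \<noteq> 0" for j using coeff_choose_poly_degree[of j] by auto
  then show ?thesis
    using assms
    by (simp add: shell_poly_def degree_mult_eq degree_pcompose degree_choose_poly pcompose_eq_0_iff)
qed

lemma coeff_shell_poly:
  assumes "m \<le> s"
  shows "coeff (shell_poly r s m) s = (-1) ^ (s - m) / (fact m * fact (s - m))"
proof -
  have "coeff (shell_poly r s m) s = lead_coeff (shell_poly r s m)"
    by (simp only: degree_shell_poly[OF assms])
  also have "\<dots> = inverse (fact m) * (inverse (fact (s - m)) * (-1) ^ (s - m))"
    by (simp only: shell_poly_def lead_coeff_mult)
       (simp add: lead_coeff_comp coeff_choose_poly_degree degree_choose_poly)
  finally show ?thesis by (simp add: field_simps)
qed

definition Lambda_poly :: "nat \<Rightarrow> nat \<Rightarrow> nat \<Rightarrow> nat \<Rightarrow> complex poly" where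
  "Lambda_poly n s r1 r2
    = smult (inverse (of_nat (r2 choose s))) (\<Sum>m\<le>s. smult (zonal n s r1 m) (shell_poly r2 s m))"

lemma poly_Lambda_poly:
  assumes "k \<le> r2"
  shows "poly (Lambda_poly n s r1 r2) (of_nat k) = inverse (of_nat (r2 choose s))
    * (\<Sum>m\<le>s. zonal n s r1 m * of_nat ((k choose m) * ((r2 - k) choose (s - m))))"
  by (simp only: Lambda_poly_def poly_smult poly_sum poly_shell_poly[OF assms])

lemma poly_Lambda_poly_0:
  assumes "s \<le> r2"
  shows "poly (Lambda_poly n s r1 r2) 0 = 1"
proof -
  have "(\<Sum>m\<le>s. zonal n s r1 m * of_nat ((0 choose m) * (r2 choose (s - m))))
    = (\<Sum>m\<in>{0}. zonal n s r1 m * of_nat ((0 choose m) * (r2 choose (s - m))))"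
    by (intro sum.mono_neutral_right) (auto simp: binomial_eq_0_iff)
  then show ?thesis
    using poly_Lambda_poly[of 0 r2 n s r1] assms by (simp add: binomial_eq_0_iff)
qed

lemma degree_Lambda_poly:
  assumes "s \<le> r2"
  shows "degree (Lambda_poly n s r1 r2) = s"
proof -
  let ?Q = "\<Sum>m\<le>s. smult (zonal n s r1 m) (shell_poly r2 s m)"
  define weight :: "nat \<Rightarrow> real" where
    "weight m = fact (r1 - s + m) * fact (n - r1 - m)
      / (fact (r1 - s) * fact (n - r1) * fact m * fact (s - m))" for m
  have "coeff (smult (zonal n s r1 m) (shell_poly r2 s m)) s = (-1) ^ s * of_real (weight m)"
    if "m \<le> s" for m
  proof -
    have "coeff (smult (zonal n s r1 m) (shell_poly r2 s m)) s
      = ((-1) ^ m * (-1) ^ (s - m)) * of_real (weight m)"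
      by (simp add: coeff_shell_poly[OF that] zonal_def weight_def mult_ac)
    then show ?thesis using that by (simp flip: power_add)
  qed
  then have "coeff ?Q s = (-1) ^ s * of_real (\<Sum>m\<le>s. weight m)"
    by (simp add: coeff_sum sum_distrib_left)
  moreover have "(\<Sum>m\<le>s. weight m) > 0" unfolding weight_def by (intro sum_pos) auto
  ultimately have "coeff ?Q s \<noteq> 0" by (simp del: of_real_sum)
  then have "degree ?Q \<ge> s" by (rule le_degree)
  moreover have "degree ?Q \<le> s"
    by (intro degree_sum_le) (auto intro: order.trans[OF degree_smult_le] simp: degree_shell_poly)
  ultimately show ?thesis using assms by (simp add: Lambda_poly_def binomial_eq_0_iff)
qed

lemma sum_subsets_shell:
  assumes fin: "finite \<Omega>" and x_sub: "x \<subseteq> \<Omega>"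
  shows "(\<Sum>z\<in>{z \<in> Xr \<Omega> s. z \<subseteq> x}. \<phi> (card (z - y)))
    = (\<Sum>m\<le>s. \<phi> m
        * (of_nat ((card (x - y) choose m) * (card (x \<inter> y) choose (s - m))) :: 'b :: comm_semiring_1))"
proof -
  have fin_x: "finite x" using x_sub fin by (rule finite_subset)
  have "card (z - y) \<le> s" if "z \<in> Xr \<Omega> s" for z
    using card_Int_Diff_Xr[OF fin that, of y] by simp
  then have "(\<Sum>z\<in>{z \<in> Xr \<Omega> s. z \<subseteq> x}. \<phi> (card (z - y)))
    = (\<Sum>m\<le>s. \<Sum>z\<in>{z \<in> {z \<in> Xr \<Omega> s. z \<subseteq> x}. card (z - y) = m}. \<phi> (card (z - y)))"
    using fin by (intro sum.group[symmetric]) auto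
  also have "\<dots> = (\<Sum>m\<le>s. \<phi> m * of_nat ((card (x - y) choose m) * (card (x \<inter> y) choose (s - m))))"
  proof (intro sum.cong refl)
    fix m assume "m \<in> {..s}"
    let ?Z = "{z \<in> {z \<in> Xr \<Omega> s. z \<subseteq> x}. card (z - y) = m}"
    have "z \<in> ?Z \<longleftrightarrow> z \<subseteq> x \<and> card (z \<inter> y) = s - m \<and> card (z - y) = m" for z
    proof (cases "z \<subseteq> x")
      case True
      have "card z = card (z \<inter> y) + card (z - y)"
        by (rule card_Int_Diff[OF finite_subset[OF True fin_x]])
      then show ?thesis using True x_sub \<open>m \<in> {..s}\<close> by (auto simp: Xr_def)
    qed simp
    then have "?Z = {z. z \<subseteq> x \<and> card (z \<inter> y) = s - m \<and> card (z - y) = m}" by blast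
    then have "card ?Z = (card (x - y) choose m) * (card (x \<inter> y) choose (s - m))"
      by (simp only: card_subsets_Int_Diff[OF fin_x] mult.commute)
    moreover have "(\<Sum>z\<in>?Z. \<phi> (card (z - y))) = of_nat (card ?Z) * \<phi> m" by simp
    ultimately show "(\<Sum>z\<in>?Z. \<phi> (card (z - y)))
      = \<phi> m * of_nat ((card (x - y) choose m) * (card (x \<inter> y) choose (s - m)))"
      by (simp only: mult.commute)
  qed
  finally show ?thesis .
qed

definition Lambda_op :: "'a set \<Rightarrow> nat \<Rightarrow> nat \<Rightarrow> nat \<Rightarrow> ('a set \<Rightarrow> complex) \<Rightarrow> 'a set \<Rightarrow> complex" where
  "Lambda_op \<Omega> s r1 r2 f = (\<lambda>x. inverse (of_nat (r2 choose s)) * lift \<Omega> s r2 (zonal_op \<Omega> s r1 f) x)"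

lemma poly_Lambda_poly_card_Diff:
  assumes fin: "finite \<Omega>" and x_mem: "x \<in> Xr \<Omega> r2"
  shows "poly (Lambda_poly (card \<Omega>) s r1 r2) (of_nat (card (x - y))) = inverse (of_nat (r2 choose s))
    * (\<Sum>z\<in>Xr \<Omega> s. of_bool (z \<subseteq> x) * zonal (card \<Omega>) s r1 (card (z - y)))"
proof -
  have x_sub: "x \<subseteq> \<Omega>" using x_mem by (simp add: Xr_def)
  have "card (x - y) \<le> r2" "card (x \<inter> y) = r2 - card (x - y)"
    using card_Int_Diff_Xr[OF fin x_mem, of y] by auto
  then have "poly (Lambda_poly (card \<Omega>) s r1 r2) (of_nat (card (x - y)))
    = inverse (of_nat (r2 choose s)) * (\<Sum>z\<in>{z \<in> Xr \<Omega> s. z \<subseteq> x}. zonal (card \<Omega>) s r1 (card (z - y)))"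
    by (simp add: poly_Lambda_poly sum_subsets_shell[OF fin x_sub])
  then show ?thesis using fin by (simp add: Int_def)
qed

lemma kernel_op_Lambda_poly:
  assumes fin: "finite \<Omega>"
  shows "kernel_op \<Omega> r1 r2 (Lambda_poly (card \<Omega>) s r1 r2) = Lambda_op \<Omega> s r1 r2"
proof (intro ext)
  fix f x
  show "kernel_op \<Omega> r1 r2 (Lambda_poly (card \<Omega>) s r1 r2) f x = Lambda_op \<Omega> s r1 r2 f x"
  proof (cases "x \<in> Xr \<Omega> r2")
    case True
    then show ?thesis
      unfolding Lambda_op_def lift_def zonal_op_def integral_op_integral_op
      by (simp only: kernel_op_def integral_op_def if_True mult.assoc poly_Lambda_poly_card_Diff[OF fin]
          sum_distrib_left[where r = "inverse (of_nat (r2 choose s))" and A = "Xr \<Omega> r1"])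
  qed (simp add: kernel_op_def Lambda_op_def lift_def integral_op_def)
qed

lemma exists_Xr_card_Diff:
  assumes fin: "finite \<Omega>" and "r1 \<le> card \<Omega>" "k \<le> r2" "r2 - k \<le> r1" "k \<le> card \<Omega> - r1"
  obtains x y where "x \<in> Xr \<Omega> r2" "y \<in> Xr \<Omega> r1" "card (x - y) = k"
proof -
  obtain y where y_sub: "y \<subseteq> \<Omega>" "card y = r1" using assms(2) by (metis obtain_subset_with_card_n)
  have fin_y: "finite y" using y_sub(1) fin by (rule finite_subset)
  obtain u where u_sub: "u \<subseteq> y" "card u = r2 - k" using assms(4) y_sub
    by (metis obtain_subset_with_card_n)
  have "card (\<Omega> - y) = card \<Omega> - r1" using y_sub fin_y by (simp add: card_Diff_subset)
  then obtain w where w_sub: "w \<subseteq> \<Omega> - y" "card w = k" using assms(5) by (metis obtain_subset_with_card_n)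
  have "card (u \<union> w) = card u + card w"
    using u_sub w_sub fin_y fin by (intro card_Un_disjoint) (auto intro: finite_subset)
  then have "u \<union> w \<in> Xr \<Omega> r2" using u_sub w_sub y_sub assms(3) by (auto simp: Xr_def)
  moreover have "u \<union> w - y = w" using u_sub w_sub by auto
  ultimately show ?thesis using y_sub w_sub by (intro that[of "u \<union> w" y]) (auto simp: Xr_def)
qed

lemma kernel_op_inject:
  assumes fin: "finite \<Omega>" and bounds: "s \<le> r1" "r1 + s \<le> card \<Omega>" "s \<le> r2" "r2 + s \<le> card \<Omega>"
    and degrees: "degree p \<le> s" "degree q \<le> s"
    and eq: "\<And>f. f \<in> L2X \<Omega> \<Longrightarrow> kernel_op \<Omega> r1 r2 p f = kernel_op \<Omega> r1 r2 q f"
  shows "p = q"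
proof -
  \<comment> \<open>The truncated difference \<open>r2 - r1\<close> is the least value of \<open>card (x - y)\<close>.\<close>
  define A :: "complex set" where "A = (\<lambda>j. of_nat (r2 - r1 + j)) ` {..s}"
  have "inj_on (\<lambda>j. of_nat (r2 - r1 + j) :: complex) {..s}"
    by (rule inj_onI) (simp only: of_nat_eq_iff add_left_cancel)
  then have "card A = Suc s" by (simp only: A_def card_image card_atMost)
  moreover have "poly p t = poly q t" if t_mem: "t \<in> A" for t
  proof -
    obtain j where "j \<le> s" and t_eq: "t = of_nat (r2 - r1 + j)" using t_mem unfolding A_def by blast
    have "r1 \<le> card \<Omega>" "r2 - r1 + j \<le> r2" "r2 - (r2 - r1 + j) \<le> r1" "r2 - r1 + j \<le> card \<Omega> - r1"
      using bounds \<open>j \<le> s\<close> by linarith+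
    then obtain x y where x_mem: "x \<in> Xr \<Omega> r2" and y_mem: "y \<in> Xr \<Omega> r1" and "card (x - y) = r2 - r1 + j"
      by (rule exists_Xr_card_Diff[OF fin])
    let ?\<delta> = "\<lambda>z. if z = y then 1 else 0 :: complex"
    have "?\<delta> \<in> L2X \<Omega>" using y_mem by (auto simp: L2X_def Xr_def)
    moreover have "kernel_op \<Omega> r1 r2 p ?\<delta> x = poly p t" for p
      using x_mem y_mem \<open>card (x - y) = _\<close> fin
      by (simp add: kernel_op_def if_distrib sum.delta t_eq cong: if_cong)
    ultimately show ?thesis using eq by metis
  qed
  ultimately show ?thesis using degrees by (intro poly_eqI_degree[of A]) auto
qed

section \<open>Identification and composition of the operators\<close>

lemma orth_compl_L2Xrs:
  assumes fin: "finite \<Omega>" and bounds: "s \<le> r" "r + s \<le> card \<Omega>"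
  shows "orth_compl \<Omega> (L2Xrs \<Omega> r s) = {f \<in> L2X \<Omega>. zonal_op \<Omega> s r f = (\<lambda>_. 0)}"
proof -
  have "(\<forall>h\<in>harmonic \<Omega> s. inner_X \<Omega> f (lift \<Omega> s r h) = 0) \<longleftrightarrow> zonal_op \<Omega> s r f = (\<lambda>_. 0)" for f
  proof
    assume orth: "\<forall>h\<in>harmonic \<Omega> s. inner_X \<Omega> f (lift \<Omega> s r h) = 0"
    let ?q = "zonal_op \<Omega> s r f"
    have q_harm: "?q \<in> harmonic \<Omega> s" by (rule zonal_op_harmonic[OF fin bounds])
    then have "inner_X \<Omega> ?q ?q = 0" using orth by (simp add: inner_X_zonal_op[OF fin q_harm bounds])
    then show "?q = (\<lambda>_. 0)" using inner_X_self_eq_0_iff[OF fin harmonicD(1)[OF q_harm]] by simp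
  next
    assume zero: "zonal_op \<Omega> s r f = (\<lambda>_. 0)"
    have "inner_X \<Omega> f (lift \<Omega> s r h) = 0" if h_harm: "h \<in> harmonic \<Omega> s" for h
    proof -
      have "inner_X \<Omega> (zonal_op \<Omega> s r f) h = 0" by (simp add: zero inner_X_def)
      moreover have "(card \<Omega> - s + 1) choose s \<noteq> 0" "(card \<Omega> - r) choose s \<noteq> 0"
        using bounds by (simp_all add: binomial_eq_0_iff)
      ultimately show ?thesis
        unfolding inner_X_zonal_op[OF fin h_harm bounds]
        by (simp only: mult_eq_0_iff divide_eq_0_iff of_nat_eq_0_iff) simp
    qed
    then show "\<forall>h\<in>harmonic \<Omega> s. inner_X \<Omega> f (lift \<Omega> s r h) = 0" by blast
  qed
  then show ?thesis
    by (auto simp: orth_compl_def L2Xrs_eq_lift_harmonic[OF fin bounds] simp flip: inner_X_def)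
qed

lemma is_Lambda_Lambda_op:
  assumes fin: "finite \<Omega>" and bounds: "s \<le> r1" "r1 + s \<le> card \<Omega>" "s \<le> r2" "r2 + s \<le> card \<Omega>"
  shows "is_Lambda \<Omega> s r1 r2 (Lambda_op \<Omega> s r1 r2)"
  unfolding is_Lambda_def
proof (intro conjI allI impI ballI)
  show "\<exists>p. degree p = s \<and> poly p 0 = 1 \<and> Lambda_op \<Omega> s r1 r2 = kernel_op \<Omega> r1 r2 p"
    using degree_Lambda_poly[OF bounds(3)] poly_Lambda_poly_0[OF bounds(3)]
      kernel_op_Lambda_poly[OF fin, symmetric] by blast
  show "Lambda_op \<Omega> s r1 r2 (act g f) = act g (Lambda_op \<Omega> s r1 r2 f)" if "g permutes \<Omega>" for g f
    unfolding kernel_op_Lambda_poly[OF fin, symmetric]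
    by (rule G_homD(3)[OF G_hom_kernel_op that UNIV_I])
  show "Lambda_op \<Omega> s r1 r2 f \<in> L2Xrs \<Omega> r2 s" for f
    unfolding L2Xrs_eq_lift_harmonic[OF fin bounds(3,4)] Lambda_op_def
    by (intro G_subspaceD(4)[OF G_subspace_image[OF G_subspace_harmonic G_hom_lift]] imageI
        zonal_op_harmonic[OF fin bounds(1,2)])
  show "Lambda_op \<Omega> s r1 r2 f = (\<lambda>_. 0)" if "f \<in> orth_compl \<Omega> (L2Xrs \<Omega> r1 s)" for f
    using that by (simp add: orth_compl_L2Xrs[OF fin bounds(1,2)] Lambda_op_def lift_def integral_op_def
        fun_eq_iff)
qed

lemma G_hom_eq_Lambda_op:
  assumes fin: "finite \<Omega>" and bounds: "s \<le> r1" "r1 + s \<le> card \<Omega>" "s \<le> r2"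
    and L_hom: "G_hom \<Omega> UNIV L" and L_range: "\<And>f. L f \<in> L2Xr \<Omega> r2"
    and L_orth: "\<And>f. f \<in> orth_compl \<Omega> (L2Xrs \<Omega> r1 s) \<Longrightarrow> L f = (\<lambda>_. 0)"
  obtains d where "\<And>f. f \<in> L2X \<Omega> \<Longrightarrow> L f = (\<lambda>x. d * Lambda_op \<Omega> s r1 r2 f x)"
proof -
  let ?e = "zonal_eigenvalue (card \<Omega>) s r1"
  have "G_hom \<Omega> (harmonic \<Omega> s) (L \<circ> lift \<Omega> s r1)"
    by (rule G_hom_comp[OF G_hom_lift L_hom]) simp
  moreover have "(L \<circ> lift \<Omega> s r1) ` harmonic \<Omega> s \<subseteq> L2Xr \<Omega> r2" using L_range by auto
  moreover have "2 * s \<le> card \<Omega>" using bounds by simp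
  ultimately obtain c where
    L_lift: "\<And>h. h \<in> harmonic \<Omega> s \<Longrightarrow> (L \<circ> lift \<Omega> s r1) h = (\<lambda>x. c * lift \<Omega> s r2 h x)"
    using G_hom_harmonic_eq_lift[OF fin] by blast
  have "L f x = inverse ?e * c * of_nat (r2 choose s) * Lambda_op \<Omega> s r1 r2 f x" if "f \<in> L2X \<Omega>" for f x
  proof -
    let ?q = "zonal_op \<Omega> s r1 f"
    have q_harm: "?q \<in> harmonic \<Omega> s" by (rule zonal_op_harmonic[OF fin bounds(1,2)])
    define v where "v = (\<lambda>x. f x + - inverse ?e * lift \<Omega> s r1 ?q x)"
    have "zonal_op \<Omega> s r1 v = (\<lambda>z. ?q z + - inverse ?e * (?e * ?q z))"
      unfolding v_def G_homD(1)[OF G_hom_zonal_op UNIV_I UNIV_I] G_homD(2)[OF G_hom_zonal_op UNIV_I]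
        zonal_op_lift[OF fin q_harm bounds(1,2)] ..
    then have "zonal_op \<Omega> s r1 v = (\<lambda>_. 0)"
      using zonal_eigenvalue_neq_0[OF bounds(1,2)] by (simp flip: mult.assoc)
    moreover have "v \<in> L2X \<Omega>"
      using that by (simp add: v_def L2X_def lift_def integral_op_def Xr_def)
    ultimately have "L v = (\<lambda>_. 0)"
      by (intro L_orth) (simp add: orth_compl_L2Xrs[OF fin bounds(1,2)])
    moreover have "L v = (\<lambda>x. L f x + - inverse ?e * (c * lift \<Omega> s r2 ?q x))"
      unfolding v_def G_homD(1)[OF L_hom UNIV_I UNIV_I] G_homD(2)[OF L_hom UNIV_I]
      using L_lift[OF q_harm] by simp
    ultimately have "L f x + - inverse ?e * (c * lift \<Omega> s r2 ?q x) = 0"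
      by (simp only: fun_eq_iff)
    then have "L f x = inverse ?e * (c * lift \<Omega> s r2 ?q x)"
      by (simp only: mult_minus_left add_uminus_conv_diff right_minus_eq)
    then show ?thesis using bounds(3) by (simp add: Lambda_op_def binomial_eq_0_iff)
  qed
  then show ?thesis by (intro that ext)
qed

lemma is_Lambda_imp_eq_Lambda_op:
  assumes fin: "finite \<Omega>" and bounds: "s \<le> r1" "r1 + s \<le> card \<Omega>" "s \<le> r2" "r2 + s \<le> card \<Omega>"
    and L_Lambda: "is_Lambda \<Omega> s r1 r2 L"
  shows "L = Lambda_op \<Omega> s r1 r2"
proof -
  let ?P = "Lambda_poly (card \<Omega>) s r1 r2"
  obtain p where "degree p = s" "poly p 0 = 1" and L_eq: "L = kernel_op \<Omega> r1 r2 p"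
    using L_Lambda by (auto simp: is_Lambda_def)
  have "G_hom \<Omega> UNIV L" unfolding L_eq by (rule G_hom_kernel_op)
  moreover have "L f \<in> L2Xr \<Omega> r2" for f by (simp add: L_eq kernel_op_def L2Xr_def)
  moreover have "L f = (\<lambda>_. 0)" if "f \<in> orth_compl \<Omega> (L2Xrs \<Omega> r1 s)" for f
    using L_Lambda that by (simp add: is_Lambda_def)
  ultimately obtain d where L_scaled: "\<And>f. f \<in> L2X \<Omega> \<Longrightarrow> L f = (\<lambda>x. d * Lambda_op \<Omega> s r1 r2 f x)"
    using G_hom_eq_Lambda_op[OF fin bounds(1-3)] by blast
  have "kernel_op \<Omega> r1 r2 p f = kernel_op \<Omega> r1 r2 (smult d ?P) f" if "f \<in> L2X \<Omega>" for f
    using L_scaled[OF that]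
    by (simp add: L_eq kernel_op_Lambda_poly[OF fin, symmetric])
       (simp add: kernel_op_def fun_eq_iff sum_distrib_left mult.assoc)
  then have p_eq: "p = smult d ?P"
    using \<open>degree p = s\<close> degree_Lambda_poly[OF bounds(3)] degree_smult_le[of d ?P]
    by (intro kernel_op_inject[OF fin bounds]) auto
  then have "d = 1" using \<open>poly p 0 = 1\<close> poly_Lambda_poly_0[OF bounds(3)] by simp
  then show ?thesis by (simp add: L_eq p_eq kernel_op_Lambda_poly[OF fin])
qed

lemma Lambda_eq_Lambda_op:
  assumes "finite \<Omega>" "s \<le> r1" "r1 + s \<le> card \<Omega>" "s \<le> r2" "r2 + s \<le> card \<Omega>"
  shows "Lambda \<Omega> s r1 r2 = Lambda_op \<Omega> s r1 r2"
  unfolding Lambda_def using is_Lambda_Lambda_op[OF assms] is_Lambda_imp_eq_Lambda_op[OF assms]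
  by (rule the_equality)

lemma Lambda_op_Lambda_op:
  assumes "finite \<Omega>" and "s \<le> r1" "r1 + s \<le> card \<Omega>" "s \<le> r2" "r2 + s \<le> card \<Omega>"
  shows "Lambda_op \<Omega> s r2 r3 (Lambda_op \<Omega> s r1 r2 f)
    = (\<lambda>x. of_nat (card \<Omega> choose r2) / specht_dim (card \<Omega>) s * Lambda_op \<Omega> s r1 r3 f x)"
proof -
  let ?q = "zonal_op \<Omega> s r1 f" and ?e = "zonal_eigenvalue (card \<Omega>) s r2"
  have "?q \<in> harmonic \<Omega> s" using assms by (intro zonal_op_harmonic)
  then have "zonal_op \<Omega> s r2 (lift \<Omega> s r2 ?q) = (\<lambda>z. ?e * ?q z)" using assms by (intro zonal_op_lift)
  then have "Lambda_op \<Omega> s r2 r3 (Lambda_op \<Omega> s r1 r2 f)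
    = (\<lambda>x. inverse (of_nat (r3 choose s)) * (inverse (of_nat (r2 choose s)) * (?e * lift \<Omega> s r3 ?q x)))"
    by (simp only: Lambda_op_def G_homD(2)[OF G_hom_zonal_op UNIV_I] G_homD(2)[OF G_hom_lift UNIV_I])
  moreover have coefficient:
    "inverse (of_nat (r2 choose s)) * ?e = of_nat (card \<Omega> choose r2) / specht_dim (card \<Omega>) s"
    using \<open>s \<le> r2\<close> by (simp add: zonal_eigenvalue_def binomial_eq_0_iff)
  ultimately show ?thesis
    unfolding coefficient[symmetric] Lambda_op_def[of \<Omega> s r1 r3] by (simp only: mult_ac)
qed

theorem theorem2:
  fixes \<Omega> :: "'a set" and n r1 r2 r3 s :: nat
  assumes "finite \<Omega>" and "card \<Omega> = n" and "n \<ge> 1"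
    and "r1 \<le> n" and "r2 \<le> n" and "r3 \<le> n"
    and "s \<le> min r1 (min (n - r1) (min r2 (min (n - r2) (min r3 (n - r3)))))"
  shows "Lambda \<Omega> s r2 r3 \<circ> Lambda \<Omega> s r1 r2 =
    (\<lambda>\<psi> x. (of_int (ichoose n (int r2)) / of_int (ichoose n (int s) - ichoose n (int s - 1)))
             * Lambda \<Omega> s r1 r3 \<psi> x)"
proof -
  have bounds: "s \<le> r1" "r1 + s \<le> card \<Omega>" "s \<le> r2" "r2 + s \<le> card \<Omega>" "s \<le> r3" "r3 + s \<le> card \<Omega>"
    using assms by auto
  note Lambda_eq = Lambda_eq_Lambda_op[OF \<open>finite \<Omega>\<close>]
  have coefficient: "of_int (ichoose n (int r2)) / of_int (ichoose n (int s) - ichoose n (int s - 1))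
    = of_nat (card \<Omega> choose r2) / specht_dim (card \<Omega>) s"
    using \<open>card \<Omega> = n\<close> by (simp add: specht_dim_def ichoose_def)
  show ?thesis
    unfolding coefficient Lambda_eq[OF bounds(1-4)] Lambda_eq[OF bounds(3-6)] Lambda_eq[OF bounds(1,2,5,6)]
    by (rule ext) (simp only: o_def Lambda_op_Lambda_op[OF \<open>finite \<Omega>\<close> bounds(1-4)])
qed

end
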